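(* Suppose $d>0$ and let $C$ be a multi-model Cantor set with models $A_1,\dots,A_n$ and with multi-model Cantor set matrix $M_d$, assumed irreducible, and let $\lambda_d$ be the Frobenius eigenvalue of $M_d$ for each $d$. Let $d$ be chosen such that $\lambda_d=1$. Then the Hausdorff measure of $C$ in this dimension is finite and non-zero, i.e. $0<\mathcal{H}_d(C)<\infty$. Therefore $d$ is the Hausdorff dimension of $C$. Also, let $\vec v=(v_1,\dots,v_n)^T$ be the Frobenius eigenvector of $M_d$ such that $\sum_{i=1}^n v_i=\mathcal{H}_d(C)$; then $v_i=\mathcal{H}_d(A_i)$ for every $i=1,\dots,n$.
   Context: A subset that is both open and closed is called a clopen. A surjective map $f:X\to Y$ of metric spaces is a similarity map with scale factor $K>0$ if $d_Y(f(x_1),f(x_2))=K\,d_X(x_1,x_2)$ for all $x_1,x_2\in X$. Multi-model Cantor set: a metric space $C$ which is a Cantor set (compact, totally disconnected, perfect, non-empty) together with the following data (a clone structure). There is a partition of $C$ into non-empty clopens $A_1,\dots,A_n$ (the models) and another partition of $C$ into non-empty clopens $E_1,\dots,E_m$ (the level-1 clones), such that each $E_i$ is contained in some $A_j$ and each $A_j$ contains at least two of the $E_i$. For each $i$ there is given a surjective similarity map $\tau_i:E_i\to A_j$ onto some model $A_j$ (with $j$ depending on $i$), called a clone map; its scale factor is greater than $1$. The level-1 clone $E_i$ is said to be of type $j$ if $\tau_i$ maps it onto $A_j$. Matrix: for $d>0$, the multi-model Cantor set matrix $M_d$ is the $n\times n$ matrix whose $(i,j)$ entry is the sum of the $d$-th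 powers of the inverses of the scale factors of the clone maps of those level-1 clones that are of type $i$ and are contained in the model $A_j$ (an empty sum being $0$). A square matrix $M$ is irreducible if all its entries are non-negative and there is some $k>0$ such that all entries of $M^k$ are positive. The Frobenius eigenvalue of an irreducible matrix is its eigenvalue of largest modulus (it is real, positive, and a simple root of the characteristic polynomial); a Frobenius eigenvector is a corresponding eigenvector with strictly positive real entries. $\mathcal{H}_d$ denotes $d$-dimensional Hausdorff measure.
   Formalization: The Frobenius eigenvector v is taken as a left eigenvector (v^T M_d = v^T) instead of M_d v = v: with entry (i,j) counting clones of type i in A_j, the measures satisfy H_d(A_j) = sum_i M_ij H_d(A_i), and the claim for M_d v = v is false in general. *)

theory Defs
  imports "HOL-Analysis.Analysis" "Jordan_Normal_Form.Char_Poly"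
begin

(* "$" is index access for vectors of the Jordan_Normal_Form type. *)
unbundle no vec_syntax

(* Conventions diam(U)^0 = 1 for nonempty U (the library has 0 powr 0 = 0) and diam({})^s = 0,
   so that the 0-dimensional measure is counting measure. *)
definition diam_pow :: "real \<Rightarrow> 'a::metric_space set \<Rightarrow> ennreal" where
  "diam_pow s U =
     (if U = {} then 0 else if s = 0 then 1 else ennreal (diameter U powr s))"

(* Boundedness is explicit because diameter is a junk value on unbounded sets.
   The infimum over no covers at all is \<infinity>. *)
definition hausdorff_premeasure ::
    "real \<Rightarrow> real \<Rightarrow> 'a::metric_space set \<Rightarrow> ennreal" where
  "hausdorff_premeasure \<delta> s S =
     (INF U \<in> {U :: nat \<Rightarrow> 'a set. S \<subseteq> (\<Union>k. U k) \<and> (\<forall>k. bounded (U k) \<and> diameter (U k) \<le> \<delta>)}.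
        \<Sum>k. diam_pow s (U k))"

definition hausdorff_measure :: "real \<Rightarrow> 'a::metric_space set \<Rightarrow> ennreal" where
  "hausdorff_measure s S = (SUP \<delta> \<in> {0<..}. hausdorff_premeasure \<delta> s S)"

definition hausdorff_dimension :: "'a::metric_space set \<Rightarrow> ennreal" where
  "hausdorff_dimension S = Inf {ennreal s | s. 0 \<le> s \<and> hausdorff_measure s S = 0}"

definition cantor_set :: "'a::metric_space set \<Rightarrow> bool" where
  "cantor_set C \<longleftrightarrow>
     C \<noteq> {} \<and> compact C \<and>
     (\<forall>x\<in>C. connected_component_set C x = {x}) \<and>
     (\<forall>x\<in>C. x islimpt C)"

definition similarity_map ::
    "real \<Rightarrow> 'a::metric_space set \<Rightarrow> 'b::metric_space set \<Rightarrow> ('a \<Rightarrow> 'b) \<Rightarrow> bool" where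
  "similarity_map K X Y f \<longleftrightarrow>
     0 < K \<and> f ` X = Y \<and> (\<forall>x1\<in>X. \<forall>x2\<in>X. dist (f x1) (f x2) = K * dist x1 x2)"

(* The family is indexed by 0, ..., n - 1. *)
definition clopen_partition ::
    "'a::topological_space set \<Rightarrow> nat \<Rightarrow> (nat \<Rightarrow> 'a set) \<Rightarrow> bool" where
  "clopen_partition C n A \<longleftrightarrow>
     (\<Union>i<n. A i) = C \<and> disjoint_family_on A {..<n} \<and>
     (\<forall>i<n. A i \<noteq> {} \<and> openin (top_of_set C) (A i) \<and> closedin (top_of_set C) (A i))"

(* A: models, E: level-1 clones, \<tau>: clone maps, K: their scale factors. *)
locale multi_model_cantor_set =
  fixes C :: "'a::metric_space set"
    and n :: nat and A :: "nat \<Rightarrow> 'a set"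
    and m :: nat and E :: "nat \<Rightarrow> 'a set"
    and \<tau> :: "nat \<Rightarrow> 'a \<Rightarrow> 'a" and K :: "nat \<Rightarrow> real"
  assumes cantor: "cantor_set C"
    and models: "clopen_partition C n A"
    and clones: "clopen_partition C m E"
    and clone_in_model: "\<And>k. k < m \<Longrightarrow> \<exists>j<n. E k \<subseteq> A j"
    and two_clones: "\<And>j. j < n \<Longrightarrow> 2 \<le> card {k. k < m \<and> E k \<subseteq> A j}"
    and clone_map: "\<And>k. k < m \<Longrightarrow> \<exists>j<n. similarity_map (K k) (E k) (A j) (\<tau> k)"
    and scale_gt_1: "\<And>k. k < m \<Longrightarrow> 1 < K k"

(* The condition \<tau> k ` E k = A i says that the clone E k is of type i. *)
definition mmcs_matrix ::
    "nat \<Rightarrow> (nat \<Rightarrow> 'a set) \<Rightarrow> nat \<Rightarrow> (nat \<Rightarrow> 'a set) \<Rightarrow> (nat \<Rightarrow> 'a \<Rightarrow> 'a) \<Rightarrow> (nat \<Rightarrow> real) \<Rightarrow> real \<Rightarrow> real mat"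
  where
  "mmcs_matrix n A m E \<tau> K d =
     mat n n (\<lambda>(i, j). \<Sum>k | k < m \<and> \<tau> k ` E k = A i \<and> E k \<subseteq> A j. (1 / K k) powr d)"

(* The notion often called "primitive". *)
definition irreducible_mat :: "real mat \<Rightarrow> bool" where
  "irreducible_mat M \<longleftrightarrow>
     square_mat M \<and>
     (\<forall>i<dim_row M. \<forall>j<dim_row M. 0 \<le> M $$ (i, j)) \<and>
     (\<exists>k>0. \<forall>i<dim_row M. \<forall>j<dim_row M. 0 < (M ^\<^sub>m k) $$ (i, j))"

(* All complex eigenvalues compete for the largest modulus. *)
definition frobenius_eigenvalue :: "real mat \<Rightarrow> real \<Rightarrow> bool" where
  "frobenius_eigenvalue M r \<longleftrightarrow>
     eigenvalue (map_mat complex_of_real M) (complex_of_real r) \<and>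
     (\<forall>z. eigenvalue (map_mat complex_of_real M) z \<longrightarrow> cmod z \<le> cmod (complex_of_real r))"

(* Eigenvectors are left eigenvectors, (\<Sum>i. v_i * M_ij) = r * v_j. In mmcs_matrix the column
   index is the containing model, so this is the side on which v_i = H_d(A_i) is an eigenvector:
   splitting A_j into its clones gives H_d(A_j) = (\<Sum>i. M_ij * H_d(A_i)). *)
definition frobenius_left_eigenvector :: "real mat \<Rightarrow> real vec \<Rightarrow> bool" where
  "frobenius_left_eigenvector M v \<longleftrightarrow>
     (\<exists>r. frobenius_eigenvalue M r \<and> eigenvector (transpose_mat M) v r) \<and>
     (\<forall>i<dim_vec v. 0 < v $ i)"

end

theory Submission
  imports Defs "Jordan_Normal_Form.Spectral_Radius"
begin

text \<open>
  Write \<open>v\<close> for a positive vector with \<open>v M = v\<close>, where \<open>M\<close> is the matrix. Covering each model by its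
  level-\<open>N\<close> cylinders and rescaling by the clone maps bounds the premeasure of \<open>A\<^sub>j\<close> at ever finer
  scales by a constant multiple of \<open>v\<^sub>j\<close>, so the measure is finite. For positivity, let the level-\<open>N\<close>
  weight of a set be the sum of \<open>v\<^sub>j / \<rho>\<^sup>d\<close> over the level-\<open>N\<close> cylinders of type \<open>j\<close> and scale factor
  \<open>\<rho>\<close> that it meets. The clones are separated by a positive distance \<open>\<epsilon>\<close>, so zooming in on a set
  until it no longer fits into a single clone shows that its weight is at most a constant times the
  \<open>d\<close>-th power of its diameter, up to an error vanishing with \<open>N\<close>; compactness and subadditivity of
  the weight then bound every cover from below. Finally, splitting each model into its clones shows
  that the vector of measures of the models is itself a fixed vector of \<open>M\<close>, and a positive fixed
  vector of a primitive matrix is unique up to scaling.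
\<close>

subsection \<open>Positive fixed vectors of primitive matrices\<close>

text \<open>The product of a row vector with \<open>M\<close>. Vectors are plain functions here, so
  that absolute values, differences and multiples need no carrier conditions.\<close>

definition row_act :: "real mat \<Rightarrow> (nat \<Rightarrow> real) \<Rightarrow> nat \<Rightarrow> real" where
  "row_act M x j = (\<Sum>i<dim_row M. x i * M $$ (i, j))"

lemma row_act_cong:
  "(\<And>i. i < dim_row M \<Longrightarrow> x i = y i) \<Longrightarrow> row_act M x = row_act M y"
  by (auto simp: row_act_def fun_eq_iff intro!: sum.cong)

lemma row_act_diff: "row_act M (\<lambda>i. x i - y i) j = row_act M x j - row_act M y j"
  by (simp add: row_act_def left_diff_distrib sum_subtractf)

lemma row_act_scale: "row_act M (\<lambda>i. c * x i) j = c * row_act M x j"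
  by (simp add: row_act_def sum_distrib_left mult.assoc)

lemma row_act_mult:
  assumes "B \<in> carrier_mat n n" "D \<in> carrier_mat n n" "j < n"
  shows "row_act D (row_act B x) j = row_act (B * D) x j"
proof -
  have "row_act D (row_act B x) j = (\<Sum>i<n. \<Sum>h<n. x h * B $$ (h, i) * D $$ (i, j))"
    using assms by (simp add: row_act_def sum_distrib_right)
  also have "\<dots> = (\<Sum>h<n. \<Sum>i<n. x h * B $$ (h, i) * D $$ (i, j))"
    by (rule sum.swap)
  also have "\<dots> = (\<Sum>h<n. x h * (B * D) $$ (h, j))"
    using assms
    by (intro sum.cong refl)
       (simp add: scalar_prod_def sum_distrib_left mult.assoc atLeast0LessThan)
  finally show ?thesis using assms by (simp add: row_act_def)
qed

lemma row_act_pow_left: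
  assumes "M \<in> carrier_mat n n" "j < n"
  shows "row_act M (row_act (M ^\<^sub>m k) x) j = row_act (M ^\<^sub>m Suc k) x j"
  using row_act_mult[OF pow_carrier_mat[OF assms(1)] assms(1,2)] by simp

text \<open>Powers unfold with the last factor on the right, so applying \<open>M\<close> after
  \<open>M ^\<^sub>m k\<close> is immediate, while applying it before takes an induction. Both
  versions together say that the two operations commute.\<close>

lemma row_act_pow_right:
  assumes M: "M \<in> carrier_mat n n" and "j < n"
  shows "row_act (M ^\<^sub>m k) (row_act M x) j = row_act (M ^\<^sub>m Suc k) x j"
  using \<open>j < n\<close>
proof (induction k arbitrary: j)
  case 0
  have "row_act (1\<^sub>m n) y j = y j" for y
    using 0 by (simp add: row_act_def if_distrib[of "(*) _"] cong: if_cong)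
  with M 0 show ?case by (simp add: left_mult_one_mat[OF M])
next
  case (Suc k)
  have "row_act (M ^\<^sub>m Suc k) (row_act M x) j = row_act M (row_act (M ^\<^sub>m k) (row_act M x)) j"
    by (rule row_act_pow_left[OF M Suc.prems, symmetric])
  also have "\<dots> = row_act M (row_act (M ^\<^sub>m Suc k) x) j"
    using M by (intro fun_cong[OF row_act_cong] Suc.IH) auto
  also have "\<dots> = row_act (M ^\<^sub>m Suc (Suc k)) x j"
    by (rule row_act_pow_left[OF M Suc.prems])
  finally show ?case .
qed

lemma row_act_pow_fixed:
  assumes M: "M \<in> carrier_mat n n" and inv: "\<And>j. j < n \<Longrightarrow> row_act M x j = x j" and "j < n"
  shows "row_act (M ^\<^sub>m k) x j = x j"
  using \<open>j < n\<close>
proof (induction k arbitrary: j)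
  case 0
  with M show ?case by (simp add: row_act_def if_distrib[of "(*) _"] cong: if_cong)
next
  case (Suc k)
  have "row_act (M ^\<^sub>m Suc k) x j = row_act M (row_act (M ^\<^sub>m k) x) j"
    by (rule row_act_pow_left[OF M Suc.prems, symmetric])
  also have "\<dots> = row_act M x j"
    using M by (intro fun_cong[OF row_act_cong] Suc.IH) auto
  finally show ?case using inv[OF Suc.prems] by simp
qed

lemma row_act_mono:
  assumes "\<And>i. i < dim_row M \<Longrightarrow> x i \<le> y i" "\<And>i. i < dim_row M \<Longrightarrow> 0 \<le> M $$ (i, j)"
  shows "row_act M x j \<le> row_act M y j"
  unfolding row_act_def by (intro sum_mono mult_right_mono assms) auto

lemma row_act_pos:
  assumes "\<And>i. i < dim_row M \<Longrightarrow> 0 \<le> x i" "h < dim_row M" "0 < x h"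
    and "\<And>i. i < dim_row M \<Longrightarrow> 0 < M $$ (i, j)"
  shows "0 < row_act M x j"
  unfolding row_act_def
proof (rule sum_pos2[of _ h])
  show "0 \<le> x i * M $$ (i, j)" if "i \<in> {..<dim_row M}" for i
    using assms(1)[of i] assms(4)[of i] that by (simp add: less_imp_le)
qed (use assms in auto)

section \<open>Growth of matrix powers and subinvariant vectors\<close>

lemma power_times_inverse_power_tendsto_0:
  fixes q :: real
  assumes "1 < q"
  shows "(\<lambda>N. of_nat N ^ p * inverse q ^ N) \<longlonglongrightarrow> 0"
proof -
  have lnq: "0 < ln q" using assms by simp
  have "filterlim (\<lambda>N. ln q * real N) at_top sequentially"
    by (rule filterlim_tendsto_pos_mult_at_top[OF tendsto_const lnq filterlim_real_sequentially])
  from filterlim_compose[OF tendsto_power_div_exp_0 this, of p]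
  have "(\<lambda>N. (ln q * real N) ^ p / exp (ln q * real N) * inverse (ln q ^ p)) \<longlonglongrightarrow> 0 * inverse (ln q ^ p)"
    by (intro tendsto_intros)
  moreover have "(ln q * real N) ^ p / exp (ln q * real N) * inverse (ln q ^ p) = of_nat N ^ p * inverse q ^ N" for N
  proof -
    have "exp (ln q * real N) = q ^ N" using assms by (simp add: exp_of_nat2_mult)
    then show ?thesis using lnq by (simp add: power_mult_distrib power_inverse divide_inverse)
  qed
  ultimately show ?thesis by simp
qed

lemma irreducible_mat_power_pos:
  assumes "M \<in> carrier_mat n n" "irreducible_mat M"
  obtains k where "\<And>i j. i < n \<Longrightarrow> j < n \<Longrightarrow> 0 < (M ^\<^sub>m k) $$ (i, j)"
proof -
  obtain k where "\<forall>i<dim_row M. \<forall>j<dim_row M. 0 < (M ^\<^sub>m k) $$ (i, j)"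
    using assms(2) unfolding irreducible_mat_def by blast
  with assms(1) show ?thesis by (intro that[of k]) simp
qed

text \<open>One strict inequality would be spread to all entries by a positive power of
  \<open>M\<close>. Iterating would then force exponential growth of the powers of \<open>M\<close>,
  whereas spectral radius at most 1 allows only polynomial growth.\<close>

lemma subinvariant_imp_invariant:
  fixes u :: "nat \<Rightarrow> real"
  assumes M: "M \<in> carrier_mat n n" and irr: "irreducible_mat M"
    and spec: "\<And>z. eigenvalue (map_mat complex_of_real M) z \<Longrightarrow> cmod z \<le> 1"
    and u0: "\<And>i. i < n \<Longrightarrow> 0 \<le> u i"
    and sub: "\<And>j. j < n \<Longrightarrow> u j \<le> row_act M u j"
    and "j < n"
  shows "row_act M u j = u j"
proof (rule ccontr)
  assume "row_act M u j \<noteq> u j"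
  with sub[OF \<open>j < n\<close>] have strict: "0 < row_act M u j - u j" by simp
  have n: "0 < n" using \<open>j < n\<close> by simp
  from irr M have M0: "0 \<le> M $$ (i, j)" if "i < n" "j < n" for i j
    using that by (auto simp: irreducible_mat_def)
  obtain k where k: "\<And>i j. i < n \<Longrightarrow> j < n \<Longrightarrow> 0 < (M ^\<^sub>m k) $$ (i, j)"
    using irreducible_mat_power_pos[OF M irr] by blast
  have Mk: "M ^\<^sub>m k \<in> carrier_mat n n" using M by simp
  \<comment> \<open>Every entry of \<open>M ^\<^sub>m k\<close> is positive and \<open>M\<close>
    commutes with it, so the gap of \<open>u\<close>, nonzero at \<open>j\<close> alone if need be,
    becomes a gap of \<open>y\<close> at every index.\<close>
  define y where "y = row_act (M ^\<^sub>m k) u"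
  have ystrict: "y i < row_act M y i" if "i < n" for i
  proof -
    have "0 < row_act (M ^\<^sub>m k) (\<lambda>i. row_act M u i - u i) i"
      by (rule row_act_pos[where h = j]) (use sub strict k Mk that \<open>j < n\<close> in auto)
    then show ?thesis
      using that by (simp add: row_act_diff y_def row_act_pow_left[OF M] row_act_pow_right[OF M] del: pow_mat.simps)
  qed
  have "\<exists>i<n. 0 < u i"
  proof (rule ccontr)
    assume "\<not> ?thesis"
    then have "u i = 0" if "i < n" for i using u0[OF that] that by force
    then have "row_act M u j = 0" "u j = 0" using M \<open>j < n\<close> by (auto simp: row_act_def)
    with strict show False by simp
  qed
  then obtain i0 where i0: "i0 < n" "0 < u i0" by blast
  have ypos: "0 < y i" if "i < n" for i
    unfolding y_def by (rule row_act_pos[where h = i0]) (use u0 i0 k Mk that in auto)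
  \<comment> \<open>The smallest growth ratio. It exceeds 1 because a minimum of finitely many
    numbers above 1 does.\<close>
  define q where "q = Min ((\<lambda>i. row_act M y i / y i) ` {..<n})"
  have q1: "1 < q"
    unfolding q_def using n ystrict ypos by (subst Min_gr_iff) auto
  have qy: "q * y i \<le> row_act M y i" if "i < n" for i
  proof -
    have "q \<le> row_act M y i / y i" unfolding q_def using that by (intro Min_le) auto
    then show ?thesis using ypos[OF that] by (simp add: pos_le_divide_eq)
  qed
  have grow: "q ^ N * y i \<le> row_act (M ^\<^sub>m N) y i" if "i < n" for i N
    using that
  proof (induction N arbitrary: i)
    case 0
    with M show ?case by (simp add: row_act_def if_distrib[of "(*) _"] cong: if_cong)
  next
    case (Suc N)
    have "q ^ Suc N * y i = q ^ N * (q * y i)" by simp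
    also have "\<dots> \<le> q ^ N * row_act M y i"
      using qy[OF Suc.prems] q1 by (intro mult_left_mono) auto
    also have "\<dots> = row_act M (\<lambda>i. q ^ N * y i) i" by (simp add: row_act_scale)
    also have "\<dots> \<le> row_act M (row_act (M ^\<^sub>m N) y) i"
      by (rule row_act_mono) (use Suc M M0 in auto)
    also have "\<dots> = row_act (M ^\<^sub>m Suc N) y i" by (rule row_act_pow_left[OF M Suc.prems])
    finally show ?case .
  qed
  let ?M = "map_mat complex_of_real M"
  have cM: "?M \<in> carrier_mat n n" using M by simp
  have "spectral_radius ?M \<le> 1"
    using spectral_radius_mem_max(1)[OF cM n] spec by (auto simp: spectrum_def)
  \<comment> \<open>Eigenvalues of modulus 1 may have nontrivial Jordan blocks as far as is known at
    this point, hence a polynomial bound instead of a constant one.\<close>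
  from spectral_radius_jnf_norm_bound_le_1_upper_triangular[OF cM this]
  obtain c1 c2 where c: "\<And>N. norm_bound (?M ^\<^sub>m N) (c1 + c2 * of_nat N ^ (n - 1))" by blast
  have pow: "map_mat complex_of_real (M ^\<^sub>m N) = ?M ^\<^sub>m N" for N
    using M by (simp add: of_real_hom.mat_hom_pow)
  have ent: "(M ^\<^sub>m N) $$ (i, h) \<le> c1 + c2 * of_nat N ^ (n - 1)" if "i < n" "h < n" for i h N
  proof -
    have "cmod ((?M ^\<^sub>m N) $$ (i, h)) \<le> c1 + c2 * of_nat N ^ (n - 1)"
      using c[of N] that cM by (auto simp: norm_bound_def)
    also have "(?M ^\<^sub>m N) $$ (i, h) = complex_of_real ((M ^\<^sub>m N) $$ (i, h))"
      using that M by (subst pow[symmetric]) auto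
    finally show ?thesis by simp
  qed
  have bound: "q ^ N * y j \<le> (\<Sum>i<n. y i) * (c1 + c2 * of_nat N ^ (n - 1))" for N
  proof -
    have "q ^ N * y j \<le> row_act (M ^\<^sub>m N) y j" by (rule grow[OF \<open>j < n\<close>])
    also have "\<dots> \<le> (\<Sum>i<n. y i * (c1 + c2 * of_nat N ^ (n - 1)))"
      unfolding row_act_def using M ypos ent \<open>j < n\<close>
      by (auto intro!: sum_mono mult_left_mono simp: less_imp_le)
    finally show ?thesis by (simp add: sum_distrib_right)
  qed
  let ?S = "\<Sum>i<n. y i"
  \<comment> \<open>After division by \<open>q ^ N\<close> the polynomial bound tends to 0, although
    it stays above the fixed positive number \<open>y j\<close>.\<close>
  have "(\<lambda>N. ?S * (c1 * inverse q ^ N + c2 * (of_nat N ^ (n - 1) * inverse q ^ N))) 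
      \<longlonglongrightarrow> ?S * (c1 * 0 + c2 * 0)"
    using q1 power_times_inverse_power_tendsto_0[OF q1]
    by (intro tendsto_intros LIMSEQ_power_zero) (auto simp: inverse_eq_divide)
  moreover have "y j \<le> ?S * (c1 * inverse q ^ N + c2 * (of_nat N ^ (n - 1) * inverse q ^ N))" for N
  proof -
    have "y j = (q ^ N * y j) * inverse q ^ N" using q1 by (simp add: power_inverse)
    also have "\<dots> \<le> (?S * (c1 + c2 * of_nat N ^ (n - 1))) * inverse q ^ N"
      using q1 by (intro mult_right_mono bound) auto
    finally show ?thesis by (simp add: algebra_simps)
  qed
  ultimately have "y j \<le> ?S * (c1 * 0 + c2 * 0)" by (intro LIMSEQ_le_const) auto
  with ypos[OF \<open>j < n\<close>] show False by simp
qed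

text \<open>A fixed vector is also fixed by a power of \<open>M\<close> with positive entries, and
  that power turns a single positive entry into a positive vector.\<close>

lemma invariant_pos:
  assumes M: "M \<in> carrier_mat n n" and irr: "irreducible_mat M"
    and u0: "\<And>i. i < n \<Longrightarrow> 0 \<le> u i" and nz: "h < n" "u h \<noteq> 0"
    and inv: "\<And>j. j < n \<Longrightarrow> row_act M u j = u j" and "j < n"
  shows "0 < u j"
proof -
  obtain k where k: "\<And>i j. i < n \<Longrightarrow> j < n \<Longrightarrow> 0 < (M ^\<^sub>m k) $$ (i, j)"
    using irreducible_mat_power_pos[OF M irr] by blast
  have "0 < row_act (M ^\<^sub>m k) u j"
    by (rule row_act_pos[where h = h]) (use M u0 nz k \<open>j < n\<close> in \<open>auto simp: less_le\<close>)
  then show ?thesis by (simp add: row_act_pow_fixed[OF M inv \<open>j < n\<close>])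
qed

section \<open>Frobenius eigenvectors as positive fixed row vectors\<close>

lemma transpose_mult_vec_eq_row_act:
  assumes "M \<in> carrier_mat n n" "w \<in> carrier_vec n" "j < n"
  shows "(transpose_mat M *\<^sub>v w) $ j = row_act M (vec_index w) j"
  using assms by (auto simp: row_act_def scalar_prod_def atLeast0LessThan mult.commute intro!: sum.cong)

text \<open>The number is a root of the real characteristic polynomial, which \<open>M\<close>
  shares with its transpose. This yields a real left eigenvector from the complex definition of the
  Frobenius eigenvalue.\<close>

lemma eigenvalue_of_real_transpose:
  assumes M: "M \<in> carrier_mat n n" and ev: "eigenvalue (map_mat complex_of_real M) (complex_of_real r)"
  shows "eigenvalue (transpose_mat M) r"
proof -
  have "poly (map_poly complex_of_real (char_poly M)) (complex_of_real r) = 0"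
    using ev M by (simp add: eigenvalue_root_char_poly[of _ n] of_real_hom.char_poly_hom[OF M])
  then have "poly (char_poly M) r = 0" by simp
  then show ?thesis using M by (simp add: eigenvalue_root_char_poly[of _ n])
qed

text \<open>The absolute values of a real left eigenvector are subinvariant by the triangle
  inequality, hence invariant, hence positive.\<close>

lemma positive_invariant_exists:
  assumes M: "M \<in> carrier_mat n n" and irr: "irreducible_mat M"
    and frob: "frobenius_eigenvalue M 1"
  obtains v where "\<And>i. i < n \<Longrightarrow> 0 < v i" "\<And>j. j < n \<Longrightarrow> row_act M v j = v j"
proof -
  have "eigenvalue (transpose_mat M) 1"
    using frob by (intro eigenvalue_of_real_transpose[OF M]) (auto simp: frobenius_eigenvalue_def)
  then obtain w where w: "w \<in> carrier_vec n" "w \<noteq> 0\<^sub>v n" "transpose_mat M *\<^sub>v w = 1 \<cdot>\<^sub>v w"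
    using M by (auto simp: eigenvalue_def eigenvector_def)
  from w obtain i0 where i0: "i0 < n" "w $ i0 \<noteq> 0" by (metis carrier_vecD eq_vecI index_zero_vec)
  have wfix: "row_act M (vec_index w) j = w $ j" if "j < n" for j
    using transpose_mult_vec_eq_row_act[OF M w(1) that] w(3) by simp
  define u where "u i = \<bar>w $ i\<bar>" for i
  have inv: "row_act M u j = u j" if "j < n" for j
  proof (rule subinvariant_imp_invariant[OF M irr _ _ _ that])
    show "cmod z \<le> 1" if "eigenvalue (map_mat complex_of_real M) z" for z
      using frob that by (auto simp: frobenius_eigenvalue_def)
    show "u j \<le> row_act M u j" if "j < n" for j
    proof -
      have "u j = \<bar>\<Sum>i<n. w $ i * M $$ (i, j)\<bar>"
        using wfix[OF that] M by (simp add: u_def row_act_def)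
      also have "\<dots> \<le> (\<Sum>i<n. \<bar>w $ i * M $$ (i, j)\<bar>)" by (rule sum_abs)
      also have "\<dots> = row_act M u j"
        using irr M that unfolding row_act_def u_def
        by (auto intro!: sum.cong simp: abs_mult irreducible_mat_def)
      finally show ?thesis .
    qed
  qed (simp add: u_def)
  have "0 < u j" if "j < n" for j
    by (rule invariant_pos[OF M irr _ _ _ inv that, of i0]) (use i0 in \<open>auto simp: u_def\<close>)
  with inv that show ?thesis by blast
qed

text \<open>Subtract the largest multiple of \<open>v\<close> that keeps the difference nonnegative.
  The difference is fixed by \<open>M\<close> and has a zero entry, so it vanishes by
  \<open>invariant_pos\<close>; equal sums then make the factor 1.\<close>

lemma positive_invariant_unique:
  assumes M: "M \<in> carrier_mat n n" and irr: "irreducible_mat M"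
    and u: "\<And>i. i < n \<Longrightarrow> 0 < u i" "\<And>j. j < n \<Longrightarrow> row_act M u j = u j"
    and v: "\<And>i. i < n \<Longrightarrow> 0 < v i" "\<And>j. j < n \<Longrightarrow> row_act M v j = v j"
    and sum: "(\<Sum>i<n. u i) = (\<Sum>i<n. v i)" and "j < n"
  shows "u j = v j"
proof -
  define c where "c = Min ((\<lambda>i. u i / v i) ` {..<n})"
  have "c \<in> (\<lambda>i. u i / v i) ` {..<n}" unfolding c_def using \<open>j < n\<close> by (intro Min_in) auto
  then obtain h where h: "h < n" "c = u h / v h" by auto
  have le: "0 \<le> u i - c * v i" if "i < n" for i
  proof -
    have "c \<le> u i / v i" unfolding c_def using that by (intro Min_le) auto
    then show ?thesis using v(1)[OF that] by (simp add: pos_le_divide_eq)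
  qed
  have hz: "u h - c * v h = 0" using h v(1)[OF h(1)] by simp
  have eq: "u i = c * v i" if "i < n" for i
  proof (rule ccontr)
    assume "u i \<noteq> c * v i"
    then have "0 < u h - c * v h"
      by (intro invariant_pos[OF M irr le that _ _ h(1)])
         (use u v in \<open>auto simp: row_act_diff row_act_scale\<close>)
    with hz show False by simp
  qed
  have "(\<Sum>i<n. v i) = c * (\<Sum>i<n. v i)"
    using sum eq by (simp add: sum_distrib_left)
  moreover have "0 < (\<Sum>i<n. v i)" using v(1) \<open>j < n\<close> by (intro sum_pos) auto
  ultimately show ?thesis using eq[OF \<open>j < n\<close>] by simp
qed

text \<open>The eigenvalue \<open>r\<close> hidden in the definition is determined there only by its
  maximal modulus, so it could be 1 or -1; nonnegativity of \<open>M\<close> and positivity of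
  \<open>v\<close> exclude -1.\<close>

lemma frobenius_left_eigenvectorD:
  assumes M: "M \<in> carrier_mat n n" and irr: "irreducible_mat M" and "0 < n"
    and frob: "frobenius_eigenvalue M 1" and v: "frobenius_left_eigenvector M v"
  shows "v \<in> carrier_vec n" "\<And>i. i < n \<Longrightarrow> 0 < v $ i"
    "\<And>j. j < n \<Longrightarrow> row_act M (vec_index v) j = v $ j"
proof -
  obtain r where r: "frobenius_eigenvalue M r" and ev: "eigenvector (transpose_mat M) v r"
    and pos: "\<And>i. i < dim_vec v \<Longrightarrow> 0 < v $ i"
    using v by (auto simp: frobenius_left_eigenvector_def)
  show vc: "v \<in> carrier_vec n" using ev M by (auto simp: eigenvector_def)
  show pos': "0 < v $ i" if "i < n" for i using pos vc that by auto
  have eq: "row_act M (vec_index v) j = r * v $ j" if "j < n" for j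
    using transpose_mult_vec_eq_row_act[OF M vc that] ev vc that by (simp add: eigenvector_def)
  have "cmod (complex_of_real r) = cmod (complex_of_real 1)"
    using r frob by (intro antisym) (auto simp: frobenius_eigenvalue_def)
  then have "\<bar>r\<bar> = 1" by simp
  moreover have "0 \<le> r"
  proof -
    have "0 \<le> row_act M (vec_index v) 0"
      unfolding row_act_def using irr M pos' \<open>0 < n\<close>
      by (intro sum_nonneg mult_nonneg_nonneg) (auto simp: irreducible_mat_def less_imp_le)
    then show ?thesis using eq[OF \<open>0 < n\<close>] pos'[OF \<open>0 < n\<close>] by (simp add: zero_le_mult_iff)
  qed
  ultimately show "row_act M (vec_index v) j = v $ j" if "j < n" for j using eq[OF that] by simp
qed

lemma frobenius_left_eigenvectorI:
  assumes M: "M \<in> carrier_mat n n" and "0 < n" and frob: "frobenius_eigenvalue M 1"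
    and v: "v \<in> carrier_vec n" "\<And>i. i < n \<Longrightarrow> 0 < v $ i"
    and inv: "\<And>j. j < n \<Longrightarrow> row_act M (vec_index v) j = v $ j"
  shows "frobenius_left_eigenvector M v"
proof -
  have "transpose_mat M *\<^sub>v v = 1 \<cdot>\<^sub>v v"
  proof (rule eq_vecI)
    show "(transpose_mat M *\<^sub>v v) $ i = (1 \<cdot>\<^sub>v v) $ i" if "i < dim_vec (1 \<cdot>\<^sub>v v)" for i
      using that v inv transpose_mult_vec_eq_row_act[OF M v(1)] by auto
  qed (use M v in auto)
  moreover have "v \<noteq> 0\<^sub>v n" using v(2)[OF \<open>0 < n\<close>] \<open>0 < n\<close> by auto
  ultimately have "eigenvector (transpose_mat M) v 1"
    using M v(1) by (auto simp: eigenvector_def)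
  with frob v show ?thesis by (auto simp: frobenius_left_eigenvector_def)
qed

subsection \<open>Hausdorff measure\<close>

lemma diam_pow_empty [simp]: "diam_pow s {} = 0"
  by (simp add: diam_pow_def)

lemma hausdorff_premeasure_le:
  assumes "S \<subseteq> (\<Union>k. U k)" "\<And>k. bounded (U k)" "\<And>k. diameter (U k) \<le> \<delta>"
  shows "hausdorff_premeasure \<delta> s S \<le> (\<Sum>k. diam_pow s (U k))"
  unfolding hausdorff_premeasure_def by (rule INF_lower) (use assms in auto)

lemma hausdorff_premeasure_greatest:
  assumes "\<And>U. S \<subseteq> (\<Union>k. U k) \<Longrightarrow> (\<And>k. bounded (U k)) \<Longrightarrow> (\<And>k. diameter (U k) \<le> \<delta>) \<Longrightarrow>
     c \<le> (\<Sum>k. diam_pow s (U k))"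
  shows "c \<le> hausdorff_premeasure \<delta> s S"
  unfolding hausdorff_premeasure_def by (rule INF_greatest) (use assms in auto)

text \<open>A positive finite factor can be cancelled in \<open>ennreal\<close>, so it moves through
  the infimum over covers.\<close>

lemma hausdorff_premeasure_mult_greatest:
  assumes "0 < c"
    and "\<And>U. S \<subseteq> (\<Union>k. U k) \<Longrightarrow> (\<And>k. bounded (U k)) \<Longrightarrow> (\<And>k. diameter (U k) \<le> \<delta>) \<Longrightarrow>
     x \<le> ennreal c * (\<Sum>k. diam_pow s (U k))"
  shows "x \<le> ennreal c * hausdorff_premeasure \<delta> s S"
proof -
  have inv: "ennreal (1 / c) * (ennreal c * y) = y" "ennreal c * (ennreal (1 / c) * y) = y" for y
    using \<open>0 < c\<close> by (simp_all add: mult.assoc[symmetric] ennreal_mult[symmetric])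
  have "ennreal (1 / c) * x \<le> hausdorff_premeasure \<delta> s S"
  proof (rule hausdorff_premeasure_greatest)
    fix U :: "nat \<Rightarrow> 'a set"
    assume "S \<subseteq> (\<Union>k. U k)" "\<And>k. bounded (U k)" "\<And>k. diameter (U k) \<le> \<delta>"
    from assms(2)[OF this]
    have "ennreal (1 / c) * x \<le> ennreal (1 / c) * (ennreal c * (\<Sum>k. diam_pow s (U k)))"
      by (intro mult_left_mono) auto
    then show "ennreal (1 / c) * x \<le> (\<Sum>k. diam_pow s (U k))" by (simp only: inv)
  qed
  then have "ennreal c * (ennreal (1 / c) * x) \<le> ennreal c * hausdorff_premeasure \<delta> s S"
    by (intro mult_left_mono) auto
  then show ?thesis by (simp only: inv)
qed

lemma hausdorff_premeasure_antimono:
  "\<delta> \<le> \<delta>' \<Longrightarrow> hausdorff_premeasure \<delta>' s S \<le> hausdorff_premeasure \<delta> s S"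
  by (rule hausdorff_premeasure_greatest, rule hausdorff_premeasure_le) (auto intro: order_trans)

lemma hausdorff_premeasure_le_diam_pow:
  assumes "bounded S" "diameter S \<le> \<delta>" "0 \<le> \<delta>"
  shows "hausdorff_premeasure \<delta> s S \<le> diam_pow s S"
proof -
  have "hausdorff_premeasure \<delta> s S \<le> (\<Sum>k. diam_pow s (if k = (0::nat) then S else {}))"
    by (rule hausdorff_premeasure_le) (use assms in auto)
  also have "\<dots> = diam_pow s S" by (subst suminf_finite[of "{0}"]) auto
  finally show ?thesis .
qed

lemma hausdorff_premeasure_empty: "0 \<le> \<delta> \<Longrightarrow> hausdorff_premeasure \<delta> s {} = 0"
  using hausdorff_premeasure_le_diam_pow[of "{}" \<delta> s] by simp

section \<open>Subadditivity, and additivity over separated sets\<close>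

lemma le_INF_add_ennreal:
  fixes b :: ennreal
  assumes "\<And>u. u \<in> I \<Longrightarrow> x \<le> b + f u"
  shows "x \<le> b + (INF u\<in>I. f u)"
proof (cases "b = Orderings.top")
  case False
  then have "x - b \<le> (INF u\<in>I. f u)"
    using assms by (intro INF_greatest) (simp add: ennreal_minus_le_iff)
  with False show ?thesis by (simp add: ennreal_minus_le_iff)
qed simp

lemma le_INF_add_INF_ennreal:
  fixes f g :: "_ \<Rightarrow> ennreal"
  assumes "\<And>u v. u \<in> I \<Longrightarrow> v \<in> J \<Longrightarrow> x \<le> f u + g v"
  shows "x \<le> (INF u\<in>I. f u) + (INF v\<in>J. g v)"
proof (rule le_INF_add_ennreal)
  fix v assume v: "v \<in> J"
  have "x \<le> g v + (INF u\<in>I. f u)"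
  proof (rule le_INF_add_ennreal)
    show "x \<le> g v + f u" if "u \<in> I" for u
      using assms[OF that v] by (simp add: add.commute)
  qed
  then show "x \<le> (INF u\<in>I. f u) + g v" by (simp add: add.commute)
qed

lemma hausdorff_premeasure_Un:
  assumes "0 \<le> \<delta>"
  shows "hausdorff_premeasure \<delta> s (S \<union> T) \<le> hausdorff_premeasure \<delta> s S + hausdorff_premeasure \<delta> s T"
  unfolding hausdorff_premeasure_def[of _ _ S] hausdorff_premeasure_def[of _ _ T]
proof (rule le_INF_add_INF_ennreal, clarsimp)
  fix U V :: "nat \<Rightarrow> 'a set"
  assume UV: "S \<subseteq> \<Union> (range U)" "\<forall>k. bounded (U k) \<and> diameter (U k) \<le> \<delta>"
    "T \<subseteq> \<Union> (range V)" "\<forall>k. bounded (V k) \<and> diameter (V k) \<le> \<delta>"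
  \<comment> \<open>The two covers form the only nonempty rows of a doubly indexed family, which
    \<open>prod_decode\<close> flattens into one sequence.\<close>
  define W where "W p = (case p of (i, k) \<Rightarrow> if i = (0::nat) then U k else if i = 1 then V k else {})" for p
  have "x \<in> (\<Union>k. W (prod_decode k))" if "x \<in> S \<union> T" for x
  proof -
    from that UV(1,3) consider k where "x \<in> U k" | k where "x \<in> V k" by blast
    then obtain i k where "x \<in> W (i, k)"
    proof cases
      case (1 k)
      then show ?thesis using that[of 0 k] by (simp add: W_def)
    next
      case (2 k)
      then show ?thesis using that[of 1 k] by (simp add: W_def)
    qed
    then have "x \<in> W (prod_decode (prod_encode (i, k)))" by simp
    then show ?thesis by blast
  qed
  moreover have "bounded (W p)" "diameter (W p) \<le> \<delta>" for p
    using UV(2,4) \<open>0 \<le> \<delta>\<close> by (simp_all add: W_def split: prod.split)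
  ultimately have "hausdorff_premeasure \<delta> s (S \<union> T) \<le> (\<Sum>k. diam_pow s (W (prod_decode k)))"
    by (intro hausdorff_premeasure_le subsetI)
  also have "\<dots> = (\<Sum>i. \<Sum>k. diam_pow s (W (i, k)))"
    by (rule suminf_ennreal_2dimen) simp
  also have "\<dots> = (\<Sum>i\<in>{0,1}. \<Sum>k. diam_pow s (W (i, k)))"
    by (rule suminf_finite) (auto simp: W_def)
  also have "\<dots> = (\<Sum>k. diam_pow s (U k)) + (\<Sum>k. diam_pow s (V k))"
    by (simp add: W_def)
  finally show "hausdorff_premeasure \<delta> s (S \<union> T) \<le> (\<Sum>k. diam_pow s (U k)) + (\<Sum>k. diam_pow s (V k))" .
qed

lemma hausdorff_premeasure_UN:
  assumes "0 \<le> \<delta>" "finite I"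
  shows "hausdorff_premeasure \<delta> s (\<Union>i\<in>I. S i) \<le> (\<Sum>i\<in>I. hausdorff_premeasure \<delta> s (S i))"
  using assms(2)
proof induction
  case empty
  then show ?case using assms by (simp add: hausdorff_premeasure_empty)
next
  case (insert i I)
  have "hausdorff_premeasure \<delta> s (S i \<union> (\<Union>i\<in>I. S i))
      \<le> hausdorff_premeasure \<delta> s (S i) + hausdorff_premeasure \<delta> s (\<Union>i\<in>I. S i)"
    by (rule hausdorff_premeasure_Un[OF assms(1)])
  also have "\<dots> \<le> hausdorff_premeasure \<delta> s (S i) + (\<Sum>i\<in>I. hausdorff_premeasure \<delta> s (S i))"
    by (intro add_left_mono insert.IH)
  finally show ?case using insert.hyps by simp
qed

text \<open>A set of diameter below \<open>\<epsilon>\<close> cannot meet both \<open>S\<close> and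
  \<open>T\<close>, so every cover of the union splits into two covers that share no nonempty
  member.\<close>

lemma hausdorff_premeasure_separated:
  assumes "\<delta> < \<epsilon>" and sep: "\<And>x y. x \<in> S \<Longrightarrow> y \<in> T \<Longrightarrow> \<epsilon> \<le> dist x y"
  shows "hausdorff_premeasure \<delta> s S + hausdorff_premeasure \<delta> s T \<le> hausdorff_premeasure \<delta> s (S \<union> T)"
proof (rule hausdorff_premeasure_greatest)
  fix U :: "nat \<Rightarrow> 'a set"
  assume U: "S \<union> T \<subseteq> \<Union> (range U)" "\<And>k. bounded (U k)" "\<And>k. diameter (U k) \<le> \<delta>"
  \<comment> \<open>Any admissible cover forces this; it makes the empty sets used as replacements
    admissible.\<close>
  have "0 \<le> \<delta>" using U(3)[of 0] diameter_ge_0[OF U(2)[of 0]] by simp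
  let ?V = "\<lambda>R k. if U k \<inter> R \<noteq> {} then U k else {}"
  have le: "hausdorff_premeasure \<delta> s R \<le> (\<Sum>k. diam_pow s (?V R k))" if "R \<subseteq> \<Union> (range U)" for R
  proof (rule hausdorff_premeasure_le)
    show "R \<subseteq> \<Union> (range (?V R))"
    proof
      fix x assume "x \<in> R"
      with that obtain k where "x \<in> U k" by blast
      with \<open>x \<in> R\<close> have "x \<in> ?V R k" by auto
      then show "x \<in> \<Union> (range (?V R))" by blast
    qed
  qed (use U(2,3) \<open>0 \<le> \<delta>\<close> in simp_all)
  have ptwise: "diam_pow s (?V S k) + diam_pow s (?V T k) \<le> diam_pow s (U k)" for k
  proof (cases "U k \<inter> S \<noteq> {} \<and> U k \<inter> T \<noteq> {}")
    case True
    then obtain x y where "x \<in> U k" "x \<in> S" "y \<in> U k" "y \<in> T" by blast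
    with sep[of x y] diameter_bounded_bound[OF U(2), of x k y] U(3)[of k] assms(1) show ?thesis by simp
  qed auto
  have "hausdorff_premeasure \<delta> s S + hausdorff_premeasure \<delta> s T
      \<le> (\<Sum>k. diam_pow s (?V S k)) + (\<Sum>k. diam_pow s (?V T k))"
    using U(1) by (intro add_mono[OF le le]) simp_all
  also have "\<dots> = (\<Sum>k. diam_pow s (?V S k) + diam_pow s (?V T k))"
    by (rule suminf_add) auto
  also have "\<dots> \<le> (\<Sum>k. diam_pow s (U k))"
    by (intro suminf_le ptwise) auto
  finally show "hausdorff_premeasure \<delta> s S + hausdorff_premeasure \<delta> s T \<le> (\<Sum>k. diam_pow s (U k))" .
qed

section \<open>Scaling under Lipschitz maps\<close>

lemma diameter_le_dist:
  assumes "0 \<le> r" "\<And>x y. x \<in> S \<Longrightarrow> y \<in> S \<Longrightarrow> dist x y \<le> r"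
  shows "diameter S \<le> r"
  using assms by (cases "S = {}") (auto simp: diameter_def intro!: cSUP_least)

lemma diameter_image_le:
  assumes lip: "\<And>x y. x \<in> S \<Longrightarrow> y \<in> S \<Longrightarrow> dist (g x) (g y) \<le> r * dist x y"
    and "0 < r" "bounded S"
  shows "bounded (g ` S)" "diameter (g ` S) \<le> r * diameter S"
proof -
  have le: "dist (g x) (g y) \<le> r * diameter S" if "x \<in> S" "y \<in> S" for x y
  proof -
    have "dist (g x) (g y) \<le> r * dist x y" by (rule lip[OF that])
    also have "\<dots> \<le> r * diameter S"
      using \<open>0 < r\<close> by (intro mult_left_mono diameter_bounded_bound[OF \<open>bounded S\<close> that]) auto
    finally show ?thesis .
  qed
  then show "bounded (g ` S)" unfolding bounded_two_points by (intro exI[of _ "r * diameter S"]) auto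
  show "diameter (g ` S) \<le> r * diameter S"
    using le \<open>0 < r\<close> diameter_ge_0[OF \<open>bounded S\<close>] by (intro diameter_le_dist) auto
qed

lemma hausdorff_premeasure_lipschitz:
  fixes g :: "'a::metric_space \<Rightarrow> 'b::metric_space"
  assumes lip: "\<And>x y. x \<in> S \<Longrightarrow> y \<in> S \<Longrightarrow> dist (g x) (g y) \<le> r * dist x y"
    and "0 < r" "0 \<le> s"
  shows "hausdorff_premeasure (r * \<delta>) s (g ` S) \<le> ennreal (r powr s) * hausdorff_premeasure \<delta> s S"
proof (rule hausdorff_premeasure_mult_greatest)
  show "0 < r powr s" using \<open>0 < r\<close> by simp
next
  fix U :: "nat \<Rightarrow> 'a set"
  assume U: "S \<subseteq> \<Union> (range U)" "\<And>k. bounded (U k)" "\<And>k. diameter (U k) \<le> \<delta>"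
  \<comment> \<open>The Lipschitz bound holds on \<open>S\<close> only, so covering sets are cut
    down to \<open>S\<close> before they are mapped.\<close>
  let ?V = "\<lambda>k. g ` (U k \<inter> S)"
  have bd: "bounded (U k \<inter> S)" for k using U(2)[of k] by (rule bounded_Int[OF disjI1])
  have V: "bounded (?V k)" "diameter (?V k) \<le> r * diameter (U k)" for k
  proof -
    show "bounded (?V k)" by (rule diameter_image_le(1)[OF _ \<open>0 < r\<close> bd]) (use lip in auto)
    have "diameter (?V k) \<le> r * diameter (U k \<inter> S)"
      by (rule diameter_image_le(2)[OF _ \<open>0 < r\<close> bd]) (use lip in auto)
    also have "\<dots> \<le> r * diameter (U k)"
      using \<open>0 < r\<close> U(2) by (intro mult_left_mono diameter_subset) auto
    finally show "diameter (?V k) \<le> r * diameter (U k)" .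
  qed
  have "hausdorff_premeasure (r * \<delta>) s (g ` S) \<le> (\<Sum>k. diam_pow s (?V k))"
  proof (rule hausdorff_premeasure_le)
    have "S \<subseteq> (\<Union>k. U k \<inter> S)" using U(1) by blast
    then have "g ` S \<subseteq> g ` (\<Union>k. U k \<inter> S)" by (rule image_mono)
    then show "g ` S \<subseteq> (\<Union>k. ?V k)" by (simp only: image_UN)
    show "diameter (?V k) \<le> r * \<delta>" for k
      using V(2)[of k] mult_left_mono[OF U(3)[of k], of r] \<open>0 < r\<close> by linarith
  qed (rule V)
  also have "\<dots> \<le> (\<Sum>k. ennreal (r powr s) * diam_pow s (U k))"
  proof (rule suminf_le)
    show "diam_pow s (?V k) \<le> ennreal (r powr s) * diam_pow s (U k)" for k
    \<comment> \<open>The exponent 0 and the empty set are the two exceptional branches of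
      \<open>diam_pow\<close>, where the \<open>powr\<close> computation does not apply.\<close>
    proof (cases "U k \<inter> S = {} \<or> s = 0")
      case False
      have "diameter (?V k) powr s \<le> (r * diameter (U k)) powr s"
        using V[of k] \<open>0 \<le> s\<close> by (intro powr_mono2 diameter_ge_0) auto
      also have "\<dots> = r powr s * diameter (U k) powr s"
        using \<open>0 < r\<close> diameter_ge_0[OF U(2)[of k]] by (simp add: powr_mult)
      finally show ?thesis
        using False by (auto simp: diam_pow_def ennreal_mult[symmetric] intro!: ennreal_leI)
    qed (use \<open>0 < r\<close> in \<open>auto simp: diam_pow_def\<close>)
  qed auto
  also have "\<dots> = ennreal (r powr s) * (\<Sum>k. diam_pow s (U k))" by simp
  finally show "hausdorff_premeasure (r * \<delta>) s (g ` S) \<le> ennreal (r powr s) * (\<Sum>k. diam_pow s (U k))" .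
qed

section \<open>Passage from the premeasure to the measure\<close>

lemma hausdorff_premeasure_le_measure:
  "0 < \<delta> \<Longrightarrow> hausdorff_premeasure \<delta> s S \<le> hausdorff_measure s S"
  unfolding hausdorff_measure_def by (rule SUP_upper) auto

lemma hausdorff_measure_least:
  "(\<And>\<delta>. 0 < \<delta> \<Longrightarrow> hausdorff_premeasure \<delta> s S \<le> c) \<Longrightarrow> hausdorff_measure s S \<le> c"
  unfolding hausdorff_measure_def by (rule SUP_least) auto

lemma hausdorff_measure_empty [simp]: "hausdorff_measure s {} = 0"
proof -
  have "hausdorff_measure s ({}::'a set) \<le> 0"
    by (rule hausdorff_measure_least) (simp add: hausdorff_premeasure_empty)
  then show ?thesis by simp
qed

lemma hausdorff_measure_separated:
  assumes "0 < \<epsilon>" and sep: "\<And>x y. x \<in> S \<Longrightarrow> y \<in> T \<Longrightarrow> \<epsilon> \<le> dist x y"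
  shows "hausdorff_measure s (S \<union> T) = hausdorff_measure s S + hausdorff_measure s T"
proof (rule antisym)
  show "hausdorff_measure s (S \<union> T) \<le> hausdorff_measure s S + hausdorff_measure s T"
  proof (rule hausdorff_measure_least)
    fix \<delta> :: real assume "0 < \<delta>"
    then have "hausdorff_premeasure \<delta> s (S \<union> T) \<le> hausdorff_premeasure \<delta> s S + hausdorff_premeasure \<delta> s T"
      by (intro hausdorff_premeasure_Un) auto
    also have "\<dots> \<le> hausdorff_measure s S + hausdorff_measure s T"
      using \<open>0 < \<delta>\<close> by (intro add_mono hausdorff_premeasure_le_measure)
    finally show "hausdorff_premeasure \<delta> s (S \<union> T) \<le> hausdorff_measure s S + hausdorff_measure s T" .
  qed
next
  \<comment> \<open>Premeasures grow as the scale shrinks, so both suprema run over a directed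
    family and can be taken at a common scale.\<close>
  have "hausdorff_measure s S + hausdorff_measure s T =
      (SUP \<delta>\<in>{0<..}. hausdorff_premeasure \<delta> s S + hausdorff_premeasure \<delta> s T)"
    unfolding hausdorff_measure_def
  proof (rule SUP_add_directed_ennreal[symmetric])
    show "\<exists>k\<in>{0<..}. hausdorff_premeasure i s S + hausdorff_premeasure j s T
        \<le> hausdorff_premeasure k s S + hausdorff_premeasure k s T" if "i \<in> {0<..}" "j \<in> {0<..}" for i j :: real
      using that by (intro bexI[of _ "min i j"] add_mono hausdorff_premeasure_antimono) auto
  qed
  also have "\<dots> \<le> hausdorff_measure s (S \<union> T)"
  proof (rule SUP_least)
    fix \<delta> :: real assume "\<delta> \<in> {0<..}"
    \<comment> \<open>A scale finer than \<open>\<delta>\<close> and below the separation, where the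
      premeasure is superadditive.\<close>
    define \<eta> where "\<eta> = min \<delta> (\<epsilon> / 2)"
    have \<eta>: "0 < \<eta>" "\<eta> < \<epsilon>" "\<eta> \<le> \<delta>" using \<open>\<delta> \<in> {0<..}\<close> \<open>0 < \<epsilon>\<close> by (auto simp: \<eta>_def)
    have "hausdorff_premeasure \<delta> s S + hausdorff_premeasure \<delta> s T
        \<le> hausdorff_premeasure \<eta> s S + hausdorff_premeasure \<eta> s T"
      by (intro add_mono hausdorff_premeasure_antimono \<eta>)
    also have "\<dots> \<le> hausdorff_premeasure \<eta> s (S \<union> T)"
      by (rule hausdorff_premeasure_separated[OF \<eta>(2) sep])
    also have "\<dots> \<le> hausdorff_measure s (S \<union> T)"
      by (rule hausdorff_premeasure_le_measure[OF \<eta>(1)])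
    finally show "hausdorff_premeasure \<delta> s S + hausdorff_premeasure \<delta> s T \<le> hausdorff_measure s (S \<union> T)" .
  qed
  finally show "hausdorff_measure s S + hausdorff_measure s T \<le> hausdorff_measure s (S \<union> T)" .
qed

lemma hausdorff_measure_UN_separated:
  assumes "finite I" "0 < \<epsilon>"
    and sep: "\<And>i j x y. i \<in> I \<Longrightarrow> j \<in> I \<Longrightarrow> i \<noteq> j \<Longrightarrow> x \<in> S i \<Longrightarrow> y \<in> S j \<Longrightarrow> \<epsilon> \<le> dist x y"
  shows "hausdorff_measure s (\<Union>i\<in>I. S i) = (\<Sum>i\<in>I. hausdorff_measure s (S i))"
  using assms(1) sep
proof (induction I)
  case (insert i I)
  have "hausdorff_measure s (S i \<union> (\<Union>i\<in>I. S i)) = hausdorff_measure s (S i) + hausdorff_measure s (\<Union>i\<in>I. S i)"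
  proof (rule hausdorff_measure_separated[OF \<open>0 < \<epsilon>\<close>])
    fix x y assume "x \<in> S i" "y \<in> (\<Union>i\<in>I. S i)"
    then show "\<epsilon> \<le> dist x y" using insert.hyps(2) by (blast intro: insert.prems)
  qed
  also have "hausdorff_measure s (\<Union>i\<in>I. S i) = (\<Sum>i\<in>I. hausdorff_measure s (S i))"
    by (rule insert.IH) (rule insert.prems, auto)
  finally show ?case using insert.hyps by simp
qed simp

lemma hausdorff_measure_lipschitz:
  fixes g :: "'a::metric_space \<Rightarrow> 'b::metric_space"
  assumes lip: "\<And>x y. x \<in> S \<Longrightarrow> y \<in> S \<Longrightarrow> dist (g x) (g y) \<le> r * dist x y"
    and "0 < r" "0 \<le> s"
  shows "hausdorff_measure s (g ` S) \<le> ennreal (r powr s) * hausdorff_measure s S"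
proof (rule hausdorff_measure_least)
  fix \<delta> :: real assume "0 < \<delta>"
  have "hausdorff_premeasure (r * (\<delta> / r)) s (g ` S) \<le> ennreal (r powr s) * hausdorff_premeasure (\<delta> / r) s S"
    by (rule hausdorff_premeasure_lipschitz) (use assms in auto)
  also have "\<dots> \<le> ennreal (r powr s) * hausdorff_measure s S"
    using \<open>0 < \<delta>\<close> \<open>0 < r\<close> by (intro mult_left_mono hausdorff_premeasure_le_measure) auto
  finally show "hausdorff_premeasure \<delta> s (g ` S) \<le> ennreal (r powr s) * hausdorff_measure s S"
    using \<open>0 < r\<close> by simp
qed

lemma similarity_map_inv_into:
  assumes "similarity_map r X Y f"
  shows "similarity_map (1 / r) Y X (inv_into X f)"
proof -
  have f: "0 < r" "f ` X = Y" "\<And>x y. x \<in> X \<Longrightarrow> y \<in> X \<Longrightarrow> dist (f x) (f y) = r * dist x y"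
    using assms by (auto simp: similarity_map_def)
  have inj: "inj_on f X"
  proof (rule inj_onI)
    fix x y assume "x \<in> X" "y \<in> X" "f x = f y"
    with f(3)[of x y] f(1) show "x = y" by simp
  qed
  have "dist (inv_into X f x) (inv_into X f y) = 1 / r * dist x y" if "x \<in> Y" "y \<in> Y" for x y
    using f(3)[of "inv_into X f x" "inv_into X f y"] that f(1,2) inj
    by (simp add: f_inv_into_f inv_into_into)
  moreover have "inv_into X f ` Y = X" using inj f(2) by force
  ultimately show ?thesis using f(1) by (simp add: similarity_map_def)
qed

text \<open>The Lipschitz estimate is applied to the map and to its inverse; the two factors are
  reciprocal.\<close>

lemma hausdorff_measure_similarity:
  assumes sim: "similarity_map r X Y f" and "0 \<le> s"
  shows "hausdorff_measure s X = ennreal ((1 / r) powr s) * hausdorff_measure s Y"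
proof (rule antisym)
  have r: "0 < r" using sim by (simp add: similarity_map_def)
  have inv: "similarity_map (1 / r) Y X (inv_into X f)" by (rule similarity_map_inv_into[OF sim])
  show "hausdorff_measure s X \<le> ennreal ((1 / r) powr s) * hausdorff_measure s Y"
    using hausdorff_measure_lipschitz[of Y "inv_into X f" "1 / r" s] inv \<open>0 \<le> s\<close>
    by (auto simp: similarity_map_def)
  have "ennreal ((1 / r) powr s) * hausdorff_measure s Y
      \<le> ennreal ((1 / r) powr s) * (ennreal (r powr s) * hausdorff_measure s X)"
    using hausdorff_measure_lipschitz[of X f r s] sim \<open>0 \<le> s\<close>
    by (intro mult_left_mono) (auto simp: similarity_map_def)
  also have "\<dots> = hausdorff_measure s X"
    using r by (simp add: mult.assoc[symmetric] ennreal_mult[symmetric] powr_divide)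
  finally show "ennreal ((1 / r) powr s) * hausdorff_measure s Y \<le> hausdorff_measure s X" .
qed

section \<open>Change of exponent and the Hausdorff dimension\<close>

lemma hausdorff_premeasure_exponent:
  assumes "0 \<le> s" "s < t" "0 < \<delta>"
  shows "hausdorff_premeasure \<delta> t S \<le> ennreal (\<delta> powr (t - s)) * hausdorff_premeasure \<delta> s S"
proof (rule hausdorff_premeasure_mult_greatest)
  show "0 < \<delta> powr (t - s)" using \<open>0 < \<delta>\<close> by simp
next
  fix U :: "nat \<Rightarrow> 'a set"
  assume U: "S \<subseteq> (\<Union>k. U k)" "\<And>k. bounded (U k)" "\<And>k. diameter (U k) \<le> \<delta>"
  have "hausdorff_premeasure \<delta> t S \<le> (\<Sum>k. diam_pow t (U k))"
    by (rule hausdorff_premeasure_le[OF U])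
  also have "\<dots> \<le> (\<Sum>k. ennreal (\<delta> powr (t - s)) * diam_pow s (U k))"
  proof (rule suminf_le)
    show "diam_pow t (U k) \<le> ennreal (\<delta> powr (t - s)) * diam_pow s (U k)" for k
    proof -
      define D where "D = diameter (U k)"
      have D: "0 \<le> D" "D \<le> \<delta>" using U(2,3)[of k] by (auto simp: D_def diameter_ge_0)
      \<comment> \<open>The conditional matches the convention of \<open>diam_pow\<close> that
        nonempty sets have 0-th power 1, while \<open>0 powr 0\<close> is 0.\<close>
      have "D powr t \<le> \<delta> powr (t - s) * (if s = 0 then 1 else D powr s)"
      proof (cases "D = 0")
        case False
        with D have "D powr t = D powr (t - s) * D powr s" by (simp add: powr_add[symmetric])
        also have "\<dots> \<le> \<delta> powr (t - s) * D powr s"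
          using D \<open>s < t\<close> by (intro mult_right_mono powr_mono2) auto
        finally show ?thesis using False by (cases "s = 0") simp_all
      qed simp
      then show ?thesis
        using \<open>0 \<le> s\<close> \<open>s < t\<close> unfolding D_def diam_pow_def
        by (auto simp: ennreal_mult[symmetric] intro!: ennreal_leI)
    qed
  qed auto
  finally show "hausdorff_premeasure \<delta> t S \<le> ennreal (\<delta> powr (t - s)) * (\<Sum>k. diam_pow s (U k))"
    by simp
qed

text \<open>At scale \<open>\<eta>\<close> the exponent \<open>t\<close> gains the factor
  \<open>\<eta> powr (t - s)\<close> over \<open>s\<close>, which tends to 0 while the measure at
  \<open>s\<close> stays a finite bound.\<close>

lemma hausdorff_measure_eq_0:
  assumes "0 \<le> s" "s < t" "hausdorff_measure s S < \<infinity>"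
  shows "hausdorff_measure t S = 0"
proof -
  obtain h where h: "hausdorff_measure s S = ennreal h" "0 \<le> h"
    using assms(3) by (cases "hausdorff_measure s S") auto
  have "hausdorff_measure t S \<le> 0"
  proof (rule hausdorff_measure_least)
    fix \<delta> :: real assume "0 < \<delta>"
    have lim: "((\<lambda>\<eta>. ennreal (\<eta> powr (t - s) * h)) \<longlongrightarrow> ennreal (0 powr (t - s) * h)) (at_right 0)"
      using \<open>s < t\<close> by (intro tendsto_ennrealI tendsto_intros) (auto simp: eventually_at_filter)
    have "hausdorff_premeasure \<delta> t S \<le> ennreal (0 powr (t - s) * h)"
    proof (rule tendsto_lowerbound[OF lim])
      show "\<forall>\<^sub>F \<eta> in at_right 0. hausdorff_premeasure \<delta> t S \<le> ennreal (\<eta> powr (t - s) * h)"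
      proof (rule eventually_mono[OF eventually_at_right_real[OF \<open>0 < \<delta>\<close>]])
        fix \<eta> assume "\<eta> \<in> {0<..<\<delta>}"
        then have "hausdorff_premeasure \<delta> t S \<le> hausdorff_premeasure \<eta> t S"
          by (intro hausdorff_premeasure_antimono) auto
        also have "\<dots> \<le> ennreal (\<eta> powr (t - s)) * hausdorff_premeasure \<eta> s S"
          using \<open>\<eta> \<in> _\<close> assms by (intro hausdorff_premeasure_exponent) auto
        also have "\<dots> \<le> ennreal (\<eta> powr (t - s)) * hausdorff_measure s S"
          using \<open>\<eta> \<in> _\<close> by (intro mult_left_mono hausdorff_premeasure_le_measure) auto
        finally show "hausdorff_premeasure \<delta> t S \<le> ennreal (\<eta> powr (t - s) * h)"
          using h by (simp add: ennreal_mult)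
      qed
    qed simp
    then show "hausdorff_premeasure \<delta> t S \<le> 0" using \<open>s < t\<close> by simp
  qed
  then show ?thesis by simp
qed

text \<open>Measure 0 at some \<open>s < d\<close> would give measure 0 at \<open>d\<close>, and
  finiteness at \<open>d\<close> gives measure 0 at every larger exponent.\<close>

lemma hausdorff_dimension_eq:
  assumes "0 < d" "0 < hausdorff_measure d S" "hausdorff_measure d S < \<infinity>"
  shows "hausdorff_dimension S = ennreal d"
  unfolding hausdorff_dimension_def
proof (rule antisym)
  show "ennreal d \<le> Inf {ennreal s |s. 0 \<le> s \<and> hausdorff_measure s S = 0}"
  proof (rule Inf_greatest, clarify)
    fix s :: real assume s: "0 \<le> s" "hausdorff_measure s S = 0"
    have "\<not> s < d" using hausdorff_measure_eq_0[OF s(1), of d S] s(2) assms(2) by auto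
    then show "ennreal d \<le> ennreal s" by (simp add: ennreal_leI)
  qed
  show "Inf {ennreal s |s. 0 \<le> s \<and> hausdorff_measure s S = 0} \<le> ennreal d"
  \<comment> \<open>The exponent \<open>d\<close> itself has positive measure, so the infimum is
    approached from above through \<open>d + e\<close>.\<close>
  proof (rule ennreal_le_epsilon)
    fix e :: real assume "0 < e"
    then have "hausdorff_measure (d + e) S = 0"
      using assms by (intro hausdorff_measure_eq_0[of d]) auto
    then have "Inf {ennreal s |s. 0 \<le> s \<and> hausdorff_measure s S = 0} \<le> ennreal (d + e)"
      using \<open>0 < d\<close> \<open>0 < e\<close>
      by (intro Inf_lower CollectI exI[of _ "d + e"]) (auto simp del: ennreal_plus)
    then show "Inf {ennreal s |s. 0 \<le> s \<and> hausdorff_measure s S = 0} \<le> ennreal d + ennreal e"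
      using \<open>0 < d\<close> \<open>0 < e\<close> by simp
  qed
qed

subsection \<open>Multi-model Cantor sets\<close>

lemma mmcs_matrix_carrier: "mmcs_matrix n A m E \<tau> K d \<in> carrier_mat n n"
  by (simp add: mmcs_matrix_def)

context multi_model_cantor_set
begin

section \<open>Types and models of clones, and the matrix as a sum over clones\<close>

definition clone_type :: "nat \<Rightarrow> nat" where
  "clone_type k = (SOME j. j < n \<and> similarity_map (K k) (E k) (A j) (\<tau> k))"

definition clone_model :: "nat \<Rightarrow> nat" where
  "clone_model k = (SOME j. j < n \<and> E k \<subseteq> A j)"

abbreviation clones_in :: "nat \<Rightarrow> nat set" where
  "clones_in j \<equiv> {k \<in> {..<m}. clone_model k = j}"

lemma clone_type:
  assumes "k < m"
  shows "clone_type k < n" "similarity_map (K k) (E k) (A (clone_type k)) (\<tau> k)"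
  using someI_ex[OF clone_map[OF assms]] by (auto simp: clone_type_def)

lemma clone_model:
  assumes "k < m"
  shows "clone_model k < n" "E k \<subseteq> A (clone_model k)"
  using someI_ex[OF clone_in_model[OF assms]] by (auto simp: clone_model_def)

lemma K_pos: "k < m \<Longrightarrow> 0 < K k"
  using scale_gt_1[of k] by simp

lemma compact_C: "compact C" and C_nonempty: "C \<noteq> {}"
  using cantor by (auto simp: cantor_set_def)

lemma C_eq_models: "C = (\<Union>j<n. A j)" and C_eq_clones: "C = (\<Union>k<m. E k)"
  using models clones by (simp_all add: clopen_partition_def)

lemma model_disjoint: "i < n \<Longrightarrow> j < n \<Longrightarrow> x \<in> A i \<Longrightarrow> x \<in> A j \<Longrightarrow> i = j"
  using models by (auto simp: clopen_partition_def disjoint_family_on_def)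

lemma clone_disjoint: "k < m \<Longrightarrow> l < m \<Longrightarrow> x \<in> E k \<Longrightarrow> x \<in> E l \<Longrightarrow> k = l"
  using clones by (auto simp: clopen_partition_def disjoint_family_on_def)

lemma model_nonempty: "j < n \<Longrightarrow> A j \<noteq> {}"
  using models by (auto simp: clopen_partition_def)

lemma clone_nonempty: "k < m \<Longrightarrow> E k \<noteq> {}"
  using clones by (auto simp: clopen_partition_def)

lemma model_subset: "j < n \<Longrightarrow> A j \<subseteq> C"
  using C_eq_models by blast

lemma n_pos: "0 < n"
  using C_nonempty C_eq_models by (cases "n = 0") auto

text \<open>Models are nonempty and pairwise disjoint, hence distinct as sets. The choice made in
  \<open>clone_type\<close> is thus forced and agrees with the condition used in
  \<open>mmcs_matrix\<close>.\<close>

lemma clone_type_iff: "k < m \<Longrightarrow> i < n \<Longrightarrow> \<tau> k ` E k = A i \<longleftrightarrow> clone_type k = i"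
proof -
  assume k: "k < m" and i: "i < n"
  have "\<tau> k ` E k = A (clone_type k)" using clone_type(2)[OF k] by (simp add: similarity_map_def)
  moreover have "clone_type k = i" if "A (clone_type k) = A i"
    using that model_disjoint[OF clone_type(1)[OF k] i] model_nonempty[OF i] by blast
  ultimately show ?thesis by blast
qed

lemma clone_model_iff: "k < m \<Longrightarrow> j < n \<Longrightarrow> E k \<subseteq> A j \<longleftrightarrow> clone_model k = j"
  using clone_model[of k] clone_nonempty[of k] model_disjoint[of "clone_model k" j] by blast

lemma model_eq_clones:
  assumes "j < n"
  shows "A j = (\<Union>k\<in>clones_in j. E k)"
proof (intro equalityI subsetI)
  fix x assume "x \<in> A j"
  then obtain k where k: "k < m" "x \<in> E k" using assms model_subset C_eq_clones by blast
  moreover have "clone_model k = j"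
    using clone_model[OF k(1)] k(2) \<open>j < n\<close> \<open>x \<in> A j\<close> model_disjoint by blast
  ultimately show "x \<in> (\<Union>k\<in>clones_in j. E k)" by blast
next
  fix x assume "x \<in> (\<Union>k\<in>clones_in j. E k)"
  then show "x \<in> A j" using clone_model(2) by blast
qed

text \<open>Grouping the clones in a model by type turns the matrix product into a sum over clones.
  In this form the fixed vector equation enters all geometric arguments.\<close>

lemma row_act_mmcs_matrix:
  assumes "j < n"
  shows "row_act (mmcs_matrix n A m E \<tau> K d) x j =
    (\<Sum>k\<in>clones_in j. (1 / K k) powr d * x (clone_type k))"
proof -
  have "{k. k < m \<and> \<tau> k ` E k = A i \<and> E k \<subseteq> A j} = {k \<in> clones_in j. clone_type k = i}" if "i < n" for i
  proof -
    have "k < m \<and> \<tau> k ` E k = A i \<and> E k \<subseteq> A j \<longleftrightarrow> k < m \<and> clone_model k = j \<and> clone_type k = i" for k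
      using clone_type_iff[OF _ that] clone_model_iff[OF _ assms] by blast
    then show ?thesis by simp
  qed
  then have "row_act (mmcs_matrix n A m E \<tau> K d) x j =
      (\<Sum>i<n. \<Sum>k\<in>{k \<in> clones_in j. clone_type k = i}. (1 / K k) powr d * x (clone_type k))"
    using assms by (simp add: row_act_def mmcs_matrix_def sum_distrib_left mult.commute)
  also have "\<dots> = (\<Sum>k\<in>clones_in j. (1 / K k) powr d * x (clone_type k))"
    using clone_type(1) by (intro sum.group) auto
  finally show ?thesis .
qed

section \<open>Positive distance between clones\<close>

text \<open>The number \<open>\<epsilon>\<close> is a Lebesgue number of the finite open cover of
  the compact set \<open>C\<close> by its clones.\<close>

lemma clone_separation:
  obtains \<epsilon> where "0 < \<epsilon>" "\<And>x. x \<in> C \<Longrightarrow> \<exists>k<m. C \<inter> ball x \<epsilon> \<subseteq> E k"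
proof -
  have "\<exists>G. open G \<and> E k = C \<inter> G" if "k < m" for k
    using clones that by (auto simp: clopen_partition_def openin_open)
  then obtain G where G: "\<And>k. k < m \<Longrightarrow> open (G k)" "\<And>k. k < m \<Longrightarrow> E k = C \<inter> G k" by metis
  have "C \<subseteq> \<Union> (G ` {..<m})" using C_eq_clones G(2) by blast
  moreover have "open H" if "H \<in> G ` {..<m}" for H using that G(1) by auto
  ultimately obtain \<epsilon> where \<epsilon>: "0 < \<epsilon>" "\<And>x. x \<in> C \<Longrightarrow> \<exists>H\<in>G ` {..<m}. ball x \<epsilon> \<subseteq> H"
    using Heine_Borel_lemma[OF compact_C] by metis
  show ?thesis
  proof (rule that[OF \<epsilon>(1)])
    fix x assume "x \<in> C"
    with \<epsilon>(2) obtain k where "k < m" "ball x \<epsilon> \<subseteq> G k" by auto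
    then show "\<exists>k<m. C \<inter> ball x \<epsilon> \<subseteq> E k" using G(2)[of k] by auto
  qed
qed

lemma clone_dist:
  assumes "\<And>x. x \<in> C \<Longrightarrow> \<exists>k<m. C \<inter> ball x \<epsilon> \<subseteq> E k" "0 < \<epsilon>"
    and "k < m" "l < m" "k \<noteq> l" "x \<in> E k" "y \<in> E l"
  shows "\<epsilon> \<le> dist x y"
proof (rule ccontr)
  assume "\<not> \<epsilon> \<le> dist x y"
  then have "y \<in> ball x \<epsilon>" "x \<in> ball x \<epsilon>" using \<open>0 < \<epsilon>\<close> by auto
  moreover have C: "x \<in> C" "y \<in> C" using assms(3-7) C_eq_clones by blast+
  moreover obtain p where "p < m" "C \<inter> ball x \<epsilon> \<subseteq> E p" using assms(1)[OF C(1)] by blast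
  ultimately have "x \<in> E p" "y \<in> E p" by blast+
  with \<open>p < m\<close> assms(3-7) show False using clone_disjoint[of k p x] clone_disjoint[of l p y] by simp
qed

lemma model_dist:
  assumes "\<And>x. x \<in> C \<Longrightarrow> \<exists>k<m. C \<inter> ball x \<epsilon> \<subseteq> E k" "0 < \<epsilon>"
    and "i < n" "j < n" "i \<noteq> j" "x \<in> A i" "y \<in> A j"
  shows "\<epsilon> \<le> dist x y"
proof -
  obtain k l where kl: "k \<in> clones_in i" "x \<in> E k" "l \<in> clones_in j" "y \<in> E l"
    using assms(3-7) model_eq_clones[of i] model_eq_clones[of j] by blast
  then show ?thesis using \<open>i \<noteq> j\<close> by (intro clone_dist[OF assms(1,2), of k l]) auto
qed

text \<open>The measure is additive over separated clones, and each clone is a scaled copy of the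
  model of its type. Once finiteness is known, this says that the measures of the models form a
  fixed row vector.\<close>

lemma hausdorff_measure_model:
  assumes "j < n" "0 \<le> d"
  shows "hausdorff_measure d (A j) =
    (\<Sum>k\<in>clones_in j. ennreal ((1 / K k) powr d) * hausdorff_measure d (A (clone_type k)))"
proof -
  obtain \<epsilon> where \<epsilon>: "0 < \<epsilon>" "\<And>x. x \<in> C \<Longrightarrow> \<exists>k<m. C \<inter> ball x \<epsilon> \<subseteq> E k"
    using clone_separation by blast
  have "hausdorff_measure d (A j) = (\<Sum>k\<in>clones_in j. hausdorff_measure d (E k))"
    unfolding model_eq_clones[OF \<open>j < n\<close>]
  proof (rule hausdorff_measure_UN_separated[OF _ \<epsilon>(1)])
    fix k l x y
    assume "k \<in> clones_in j" "l \<in> clones_in j" "k \<noteq> l" "x \<in> E k" "y \<in> E l"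
    then show "\<epsilon> \<le> dist x y" by (intro clone_dist[OF \<epsilon>(2,1)]) auto
  qed simp
  also have "\<dots> = (\<Sum>k\<in>clones_in j. ennreal ((1 / K k) powr d) * hausdorff_measure d (A (clone_type k)))"
    by (intro sum.cong refl hausdorff_measure_similarity[OF clone_type(2) \<open>0 \<le> d\<close>]) auto
  finally show ?thesis .
qed

lemma hausdorff_measure_C: "hausdorff_measure d C = (\<Sum>j<n. hausdorff_measure d (A j))"
proof -
  obtain \<epsilon> where \<epsilon>: "0 < \<epsilon>" "\<And>x. x \<in> C \<Longrightarrow> \<exists>k<m. C \<inter> ball x \<epsilon> \<subseteq> E k"
    using clone_separation by blast
  show ?thesis
    unfolding C_eq_models
  proof (rule hausdorff_measure_UN_separated[OF _ \<epsilon>(1)])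
    fix i j x y
    assume "i \<in> {..<n}" "j \<in> {..<n}" "i \<noteq> j" "x \<in> A i" "y \<in> A j"
    then show "\<epsilon> \<le> dist x y" by (intro model_dist[OF \<epsilon>(2,1)]) auto
  qed simp
qed

section \<open>Finiteness of the measure\<close>

lemma scale_lower_bound:
  obtains \<kappa> where "1 < \<kappa>" "\<And>k. k < m \<Longrightarrow> \<kappa> \<le> K k"
proof
  \<comment> \<open>The extra element 2 makes the minimum meaningful without a proof that clones
    exist.\<close>
  let ?S = "insert 2 (K ` {..<m})"
  show "1 < Min ?S" using scale_gt_1 by (subst Min_gr_iff) auto
  show "Min ?S \<le> K k" if "k < m" for k using that by (intro Min_le) auto
qed

text \<open>A cover of a model at level \<open>Suc N\<close> is assembled from contracted covers of
  the types of its clones at level \<open>N\<close>. Each contraction is at least by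
  \<open>\<kappa>\<close> and scales the cost by \<open>(1 / K k) powr d\<close>; the fixed vector
  equation restores the total \<open>c * v j\<close>.\<close>

lemma hausdorff_premeasure_model_le:
  fixes v :: "nat \<Rightarrow> real"
  assumes "0 < d" and v: "\<And>j. j < n \<Longrightarrow> 0 < v j"
    and inv: "\<And>j. j < n \<Longrightarrow> (\<Sum>k\<in>clones_in j. (1 / K k) powr d * v (clone_type k)) = v j"
    and \<kappa>: "1 < \<kappa>" "\<And>k. k < m \<Longrightarrow> \<kappa> \<le> K k"
    and D: "0 \<le> D" "\<And>j. j < n \<Longrightarrow> diameter (A j) \<le> D"
    and c: "0 \<le> c" "\<And>j. j < n \<Longrightarrow> D powr d \<le> c * v j"
    and "j < n"
  shows "hausdorff_premeasure (D * (1 / \<kappa>) ^ N) d (A j) \<le> ennreal (c * v j)"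
  using \<open>j < n\<close>
proof (induction N arbitrary: j)
  case 0
  have bd: "bounded (A j)"
    using compact_imp_bounded[OF compact_C] bounded_subset model_subset[OF 0] by blast
  have "hausdorff_premeasure D d (A j) \<le> diam_pow d (A j)"
    by (rule hausdorff_premeasure_le_diam_pow[OF bd D(2)[OF 0] D(1)])
  also have "\<dots> \<le> ennreal (D powr d)"
    using \<open>0 < d\<close> D(2)[OF 0] diameter_ge_0[OF bd]
    by (auto simp: diam_pow_def intro!: ennreal_leI powr_mono2)
  also have "\<dots> \<le> ennreal (c * v j)" by (intro ennreal_leI c 0)
  finally show ?case by simp
next
  case (Suc N)
  let ?\<delta> = "\<lambda>N. D * (1 / \<kappa>) ^ N"
  have clone: "hausdorff_premeasure (?\<delta> (Suc N)) d (E k) \<le> ennreal ((1 / K k) powr d * (c * v (clone_type k)))"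
    if "k < m" for k
  proof -
    let ?g = "inv_into (E k) (\<tau> k)"
    have g: "similarity_map (1 / K k) (A (clone_type k)) (E k) ?g"
      by (rule similarity_map_inv_into[OF clone_type(2)[OF that]])
    \<comment> \<open>A clone with factor above \<open>\<kappa>\<close> leaves room: before
      contraction its cover may be coarser than level \<open>N\<close> demands, and coarser scales
      only lower the premeasure.\<close>
    have le: "?\<delta> N \<le> K k * ?\<delta> (Suc N)"
    proof -
      have "?\<delta> N = \<kappa> * ?\<delta> (Suc N)" using \<kappa>(1) by simp
      also have "\<dots> \<le> K k * ?\<delta> (Suc N)"
        using \<kappa> D(1) that by (intro mult_right_mono) auto
      finally show ?thesis .
    qed
    have "hausdorff_premeasure (1 / K k * (K k * ?\<delta> (Suc N))) d (?g ` A (clone_type k))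
        \<le> ennreal ((1 / K k) powr d) * hausdorff_premeasure (K k * ?\<delta> (Suc N)) d (A (clone_type k))"
      using g \<open>0 < d\<close> by (intro hausdorff_premeasure_lipschitz) (auto simp: similarity_map_def)
    also have "\<dots> \<le> ennreal ((1 / K k) powr d) * hausdorff_premeasure (?\<delta> N) d (A (clone_type k))"
      by (intro mult_left_mono hausdorff_premeasure_antimono le) auto
    also have "\<dots> \<le> ennreal ((1 / K k) powr d) * ennreal (c * v (clone_type k))"
      by (intro mult_left_mono Suc.IH clone_type(1) that) auto
    also have "\<dots> = ennreal ((1 / K k) powr d * (c * v (clone_type k)))"
      using c(1) v[OF clone_type(1)[OF that]] by (intro ennreal_mult[symmetric]) auto
    also have "1 / K k * (K k * ?\<delta> (Suc N)) = ?\<delta> (Suc N)" using K_pos[OF that] by simp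
    also have "?g ` A (clone_type k) = E k" using g by (simp add: similarity_map_def)
    finally show ?thesis .
  qed
  have nonneg: "0 \<le> ?\<delta> (Suc N)" using D(1) \<kappa>(1) by simp
  have "hausdorff_premeasure (?\<delta> (Suc N)) d (A j)
      \<le> (\<Sum>k\<in>clones_in j. hausdorff_premeasure (?\<delta> (Suc N)) d (E k))"
    unfolding model_eq_clones[OF Suc.prems] by (rule hausdorff_premeasure_UN[OF nonneg]) simp
  also have "\<dots> \<le> (\<Sum>k\<in>clones_in j. ennreal ((1 / K k) powr d * (c * v (clone_type k))))"
    by (intro sum_mono clone) auto
  also have "\<dots> = ennreal (\<Sum>k\<in>clones_in j. (1 / K k) powr d * (c * v (clone_type k)))"
    using c(1) v clone_type(1) by (intro sum_ennreal) (auto simp: less_imp_le)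
  also have "(\<Sum>k\<in>clones_in j. (1 / K k) powr d * (c * v (clone_type k))) = c * v j"
    using inv[OF Suc.prems] by (simp add: sum_distrib_left[symmetric] mult.left_commute[of _ c])
  finally show ?case .
qed

lemma hausdorff_measure_model_finite:
  fixes v :: "nat \<Rightarrow> real"
  assumes "0 < d" and v: "\<And>j. j < n \<Longrightarrow> 0 < v j"
    and inv: "\<And>j. j < n \<Longrightarrow> (\<Sum>k\<in>clones_in j. (1 / K k) powr d * v (clone_type k)) = v j"
    and "j < n"
  shows "hausdorff_measure d (A j) < \<infinity>"
proof -
  obtain \<kappa> where \<kappa>: "1 < \<kappa>" "\<And>k. k < m \<Longrightarrow> \<kappa> \<le> K k" using scale_lower_bound by blast
  define D where "D = diameter C"
  have bd: "bounded C" by (rule compact_imp_bounded[OF compact_C])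
  have D: "0 \<le> D" "diameter (A i) \<le> D" if "i < n" for i
    using diameter_ge_0[OF bd] diameter_subset[OF model_subset bd] that by (auto simp: D_def)
  \<comment> \<open>A sum of nonnegative terms dominates each of them, so this single constant
    serves all models.\<close>
  define c where "c = (\<Sum>i<n. D powr d / v i)"
  have c: "0 \<le> c" unfolding c_def using v by (intro sum_nonneg) (auto simp: less_imp_le)
  have cv: "D powr d \<le> c * v i" if "i < n" for i
  proof -
    have "D powr d / v i \<le> c"
      unfolding c_def using v that by (intro member_le_sum) (auto simp: less_imp_le)
    then show ?thesis using v[OF that] by (simp add: pos_divide_le_eq)
  qed
  have "hausdorff_measure d (A j) \<le> ennreal (c * v j)"
  proof (rule hausdorff_measure_least)
    fix \<delta> :: real assume "0 < \<delta>"
    have "(\<lambda>N. D * (1 / \<kappa>) ^ N) \<longlonglongrightarrow> D * 0"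
      using \<kappa>(1) by (intro tendsto_intros LIMSEQ_power_zero) auto
    then have "\<forall>\<^sub>F N in sequentially. D * (1 / \<kappa>) ^ N < \<delta>"
      using \<open>0 < \<delta>\<close> by (intro order_tendstoD) auto
    then obtain N where N: "D * (1 / \<kappa>) ^ N < \<delta>" by (auto simp: eventually_sequentially)
    then have "hausdorff_premeasure \<delta> d (A j) \<le> hausdorff_premeasure (D * (1 / \<kappa>) ^ N) d (A j)"
      by (intro hausdorff_premeasure_antimono) auto
    also have "\<dots> \<le> ennreal (c * v j)"
      by (rule hausdorff_premeasure_model_le[OF \<open>0 < d\<close> v inv \<kappa> D c cv \<open>j < n\<close>]) (use n_pos in auto)
    finally show "hausdorff_premeasure \<delta> d (A j) \<le> ennreal (c * v j)" .
  qed
  also have "\<dots> < \<infinity>" by simp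
  finally show ?thesis .
qed

text \<open>Plays the role of the self-similar measure on level-\<open>N\<close> cylinders, which thus need not be
  constructed.\<close>
primrec weight :: "real \<Rightarrow> (nat \<Rightarrow> real) \<Rightarrow> nat \<Rightarrow> 'a set \<Rightarrow> real" where
  "weight d v 0 S = (\<Sum>j<n. if S \<inter> A j = {} then 0 else v j)"
| "weight d v (Suc N) S = (\<Sum>k<m. (1 / K k) powr d * weight d v N (\<tau> k ` (S \<inter> E k)))"

section \<open>Cylinder weights and positivity of the measure\<close>

lemma weight_empty [simp]: "weight d v N {} = 0"
  by (induction N) auto

lemma weight_mono:
  assumes "\<And>j. j < n \<Longrightarrow> 0 \<le> v j" "S \<subseteq> T"
  shows "weight d v N S \<le> weight d v N T"
  using assms(2)
proof (induction N arbitrary: S T)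
  case 0
  then have "(if S \<inter> A j = {} then 0 else v j) \<le> (if T \<inter> A j = {} then 0 else v j)" if "j < n" for j
    using assms(1)[OF that] by auto
  then show ?case unfolding weight.simps by (intro sum_mono) simp
next
  case (Suc N)
  then have "\<tau> k ` (S \<inter> E k) \<subseteq> \<tau> k ` (T \<inter> E k)" for k by blast
  then show ?case unfolding weight.simps by (intro sum_mono mult_left_mono Suc.IH) auto
qed

lemma weight_Un:
  assumes "\<And>j. j < n \<Longrightarrow> 0 \<le> v j"
  shows "weight d v N (S \<union> T) \<le> weight d v N S + weight d v N T"
proof (induction N arbitrary: S T)
  case 0
  have "(if (S \<union> T) \<inter> A j = {} then 0 else v j) \<le>
      (if S \<inter> A j = {} then 0 else v j) + (if T \<inter> A j = {} then 0 else v j)" if "j < n" for j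
    using assms[OF that] by (auto simp: Int_Un_distrib2)
  then show ?case unfolding weight.simps sum.distrib[symmetric] by (intro sum_mono) simp
next
  case (Suc N)
  have "\<tau> k ` ((S \<union> T) \<inter> E k) = \<tau> k ` (S \<inter> E k) \<union> \<tau> k ` (T \<inter> E k)" for k by blast
  then have "weight d v (Suc N) (S \<union> T) \<le>
      (\<Sum>k<m. (1 / K k) powr d * (weight d v N (\<tau> k ` (S \<inter> E k)) + weight d v N (\<tau> k ` (T \<inter> E k))))"
    unfolding weight.simps by (intro sum_mono mult_left_mono) (simp_all only: Suc powr_ge_zero)
  then show ?case by (simp add: distrib_left sum.distrib)
qed

lemma weight_UN:
  assumes v: "\<And>j. j < n \<Longrightarrow> 0 \<le> v j" and "finite I"
  shows "weight d v N (\<Union>i\<in>I. S i) \<le> (\<Sum>i\<in>I. weight d v N (S i))"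
  using assms(2)
proof (induction I)
  case (insert i I)
  have "weight d v N (S i \<union> (\<Union>i\<in>I. S i)) \<le> weight d v N (S i) + weight d v N (\<Union>i\<in>I. S i)"
    by (rule weight_Un[OF v])
  also have "\<dots> \<le> weight d v N (S i) + (\<Sum>i\<in>I. weight d v N (S i))"
    by (intro add_left_mono insert.IH)
  finally show ?case using insert.hyps by simp
qed simp

lemma weight_subset_clone:
  assumes "S \<subseteq> E k" "k < m"
  shows "weight d v (Suc N) S = (1 / K k) powr d * weight d v N (\<tau> k ` S)"
proof -
  have "weight d v (Suc N) S = (\<Sum>l\<in>{k}. (1 / K l) powr d * weight d v N (\<tau> l ` (S \<inter> E l)))"
    unfolding weight.simps
  proof (rule sum.mono_neutral_right)
    show "\<forall>l\<in>{..<m} - {k}. (1 / K l) powr d * weight d v N (\<tau> l ` (S \<inter> E l)) = 0"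
    proof
      fix l assume l: "l \<in> {..<m} - {k}"
      then have "S \<inter> E l = {}" using assms clone_disjoint[of k l] by blast
      then show "(1 / K l) powr d * weight d v N (\<tau> l ` (S \<inter> E l)) = 0" by simp
    qed
  qed (use assms in auto)
  moreover have "S \<inter> E k = S" using assms by blast
  ultimately show ?thesis by simp
qed

text \<open>A clone map sends a clone onto a whole model, so the recursion for the weight of a model
  is exactly the fixed vector equation. The total weight is therefore the same at all
  levels.\<close>

lemma weight_model:
  assumes inv: "\<And>j. j < n \<Longrightarrow> (\<Sum>k\<in>clones_in j. (1 / K k) powr d * v (clone_type k)) = v j"
    and "j < n"
  shows "weight d v N (A j) = v j"
  using \<open>j < n\<close>
proof (induction N arbitrary: j)
  case 0
  have "A j \<inter> A i = {} \<longleftrightarrow> i \<noteq> j" if "i < n" for i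
    using that 0 model_disjoint[of i j] model_nonempty[OF 0] by blast
  then have "weight d v 0 (A j) = (\<Sum>i<n. if i = j then v i else 0)"
    unfolding weight.simps by (intro sum.cong) auto
  then show ?case using 0 by simp
next
  case (Suc N)
  have "(1 / K k) powr d * weight d v N (\<tau> k ` (A j \<inter> E k)) =
      (if clone_model k = j then (1 / K k) powr d * v (clone_type k) else 0)" if "k < m" for k
  proof (cases "clone_model k = j")
    case True
    then have "A j \<inter> E k = E k" using clone_model(2)[OF that] by blast
    moreover have "\<tau> k ` E k = A (clone_type k)"
      using clone_type[OF that] clone_type_iff[OF that] by blast
    ultimately show ?thesis using True Suc.IH[OF clone_type(1)[OF that]] by simp
  next
    case False
    then have "A j \<inter> E k = {}"
      using clone_model[OF that] Suc.prems model_disjoint[of j "clone_model k"] by blast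
    then show ?thesis using False by simp
  qed
  then have "weight d v (Suc N) (A j) =
      (\<Sum>k<m. if clone_model k = j then (1 / K k) powr d * v (clone_type k) else 0)"
    unfolding weight.simps by (intro sum.cong) auto
  also have "\<dots> = v j"
    unfolding sum.inter_filter[OF finite_lessThan, symmetric] by (rule inv[OF Suc.prems])
  finally show ?case .
qed

text \<open>A set of diameter below \<open>\<epsilon>\<close> lies in one clone. Its clone map
  stretches the diameter by \<open>K k\<close>, and the weight carries the matching factor
  \<open>(1 / K k) powr d\<close>, so the bound passes down one level. The \<open>max\<close> is
  needed because level \<open>N\<close> does not resolve sets smaller than its cylinders.\<close>

lemma weight_le:
  assumes "0 < d" and v: "\<And>j. j < n \<Longrightarrow> 0 \<le> v j"
    and inv: "\<And>j. j < n \<Longrightarrow> (\<Sum>k\<in>clones_in j. (1 / K k) powr d * v (clone_type k)) = v j"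
    and \<epsilon>: "0 < \<epsilon>" "\<And>x. x \<in> C \<Longrightarrow> \<exists>k<m. C \<inter> ball x \<epsilon> \<subseteq> E k"
    and \<kappa>: "1 < \<kappa>" "\<And>k. k < m \<Longrightarrow> \<kappa> \<le> K k"
    and "U \<subseteq> C"
  shows "weight d v N U \<le> (\<Sum>j<n. v j) / \<epsilon> powr d * max (diameter U) (\<epsilon> * (1 / \<kappa>) ^ N) powr d"
  using \<open>U \<subseteq> C\<close>
proof (induction N arbitrary: U)
  have sum0: "0 \<le> (\<Sum>j<n. v j)" using v by (intro sum_nonneg) auto
  \<comment> \<open>Once the comparison length reaches \<open>\<epsilon>\<close>, the total weight
    is already a sufficient bound. This covers large sets and all of level 0, where the
    \<open>max\<close> is at least \<open>\<epsilon>\<close>.\<close>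
  have large: "weight d v N U \<le> (\<Sum>j<n. v j) / \<epsilon> powr d * r powr d"
    if "U \<subseteq> C" "\<epsilon> \<le> r" for N U r
  proof -
    have "weight d v N U \<le> weight d v N (\<Union>j<n. A j)"
      using that C_eq_models by (intro weight_mono v) auto
    also have "\<dots> \<le> (\<Sum>j<n. weight d v N (A j))" by (intro weight_UN v) auto
    also have "\<dots> = (\<Sum>j<n. v j)" by (intro sum.cong refl weight_model inv) auto
    also have "\<dots> = (\<Sum>j<n. v j) / \<epsilon> powr d * \<epsilon> powr d" using \<open>0 < \<epsilon>\<close> by simp
    also have "\<dots> \<le> (\<Sum>j<n. v j) / \<epsilon> powr d * r powr d"
      using that \<epsilon>(1) \<open>0 < d\<close> sum0 by (intro mult_left_mono powr_mono2) auto
    finally show ?thesis .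
  qed
  {
    case 0
    then show ?case by (intro large) auto
  next
    case (Suc N)
    let ?r = "\<lambda>N. \<epsilon> * (1 / \<kappa>) ^ N"
    have bd: "bounded U" using compact_imp_bounded[OF compact_C] bounded_subset Suc.prems by blast
    consider "\<epsilon> \<le> diameter U" | "U = {}" | "diameter U < \<epsilon>" "U \<noteq> {}" by linarith
    then show ?case
    proof cases
      case 1
      with Suc.prems show ?thesis by (intro large) auto
    next
      case 2
      then show ?thesis using sum0 by simp
    next
      case 3
      then obtain x where x: "x \<in> U" by blast
      then obtain k where k: "k < m" "C \<inter> ball x \<epsilon> \<subseteq> E k" using \<epsilon>(2) Suc.prems by blast
      have "U \<subseteq> C \<inter> ball x \<epsilon>"
        using diameter_bounded_bound[OF bd x] 3(1) Suc.prems by force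
      with k have UE: "U \<subseteq> E k" by blast
      have sim: "dist (\<tau> k y) (\<tau> k z) = K k * dist y z" if "y \<in> U" "z \<in> U" for y z
        using clone_type(2)[OF k(1)] UE that by (auto simp: similarity_map_def)
      have "\<tau> k ` E k = A (clone_type k)"
        using clone_type(2)[OF k(1)] by (simp add: similarity_map_def)
      then have sub: "\<tau> k ` U \<subseteq> C" using UE model_subset[OF clone_type(1)[OF k(1)]] by blast
      have diam: "diameter (\<tau> k ` U) \<le> K k * diameter U"
        by (rule diameter_image_le(2)) (use sim K_pos[OF k(1)] bd in auto)
      \<comment> \<open>The error length at level \<open>N\<close>, pulled back through the clone
        map, shrinks by at least \<open>\<kappa>\<close> and so fits under the one at level
        \<open>Suc N\<close>.\<close>
      have step: "?r N / K k \<le> ?r (Suc N)"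
      proof -
        have "?r N / K k \<le> ?r N / \<kappa>"
          using \<kappa>(1) \<kappa>(2)[OF k(1)] \<epsilon>(1) by (intro divide_left_mono) auto
        then show ?thesis by simp
      qed
      have "diameter (\<tau> k ` U) / K k \<le> diameter U"
        using diam K_pos[OF k(1)] by (simp add: pos_divide_le_eq mult.commute)
      with step have "max (diameter (\<tau> k ` U)) (?r N) / K k \<le> max (diameter U) (?r (Suc N))"
        by (cases "diameter (\<tau> k ` U) \<le> ?r N") (simp_all only: max.absorb1 max.absorb2 le_max_iff_disj not_le less_imp_le simp_thms)
      then have max: "(max (diameter (\<tau> k ` U)) (?r N) / K k) powr d \<le> max (diameter U) (?r (Suc N)) powr d"
        using K_pos[OF k(1)] \<open>0 < d\<close> \<epsilon>(1) \<kappa>(1) by (intro powr_mono2) (auto simp: le_max_iff_disj)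
      have "weight d v (Suc N) U = (1 / K k) powr d * weight d v N (\<tau> k ` U)"
        by (rule weight_subset_clone[OF UE k(1)])
      also have "\<dots> \<le> (1 / K k) powr d *
          ((\<Sum>j<n. v j) / \<epsilon> powr d * max (diameter (\<tau> k ` U)) (?r N) powr d)"
        by (intro mult_left_mono Suc.IH sub) auto
      also have "\<dots> = (\<Sum>j<n. v j) / \<epsilon> powr d * (max (diameter (\<tau> k ` U)) (?r N) / K k) powr d"
        using K_pos[OF k(1)] \<epsilon>(1) \<kappa>(1) by (simp add: powr_divide le_max_iff_disj)
      also have "\<dots> \<le> (\<Sum>j<n. v j) / \<epsilon> powr d * max (diameter U) (?r (Suc N)) powr d"
        using sum0 by (intro mult_left_mono max) auto
      finally show ?thesis .
    qed
  }
qed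

text \<open>The model with index 0, which exists because \<open>0 < n\<close>, keeps weight
  \<open>v 0\<close> at every level, and subadditivity distributes it over the cover. The index set
  is finite, so the level-dependent error vanishes in the limit.\<close>

lemma finite_cover_lower_bound:
  assumes "0 < d" and v: "\<And>j. j < n \<Longrightarrow> 0 < v j"
    and inv: "\<And>j. j < n \<Longrightarrow> (\<Sum>k\<in>clones_in j. (1 / K k) powr d * v (clone_type k)) = v j"
    and \<epsilon>: "0 < \<epsilon>" "\<And>x. x \<in> C \<Longrightarrow> \<exists>k<m. C \<inter> ball x \<epsilon> \<subseteq> E k"
    and I: "finite I" "C = (\<Union>i\<in>I. W i)"
  shows "v 0 * \<epsilon> powr d / (\<Sum>j<n. v j) \<le> (\<Sum>i\<in>I. diameter (W i) powr d)"
proof -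
  obtain \<kappa> where \<kappa>: "1 < \<kappa>" "\<And>k. k < m \<Longrightarrow> \<kappa> \<le> K k" using scale_lower_bound by blast
  have v0: "\<And>j. j < n \<Longrightarrow> 0 \<le> v j" using v by (simp add: less_imp_le)
  have sum0: "0 < (\<Sum>j<n. v j)" using v n_pos by (intro sum_pos) auto
  define c where "c = (\<Sum>j<n. v j) / \<epsilon> powr d"
  have c: "0 < c" using sum0 \<epsilon>(1) by (simp add: c_def)
  have bound: "v 0 \<le> (\<Sum>i\<in>I. c * (diameter (W i) powr d + (\<epsilon> * (1 / \<kappa>) ^ N) powr d))" for N
  proof -
    have "v 0 = weight d v N (A 0)" by (rule weight_model[OF inv n_pos, symmetric])
    also have "\<dots> \<le> weight d v N (\<Union>i\<in>I. W i)"
      using model_subset[OF n_pos] I(2) by (intro weight_mono v0) auto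
    also have "\<dots> \<le> (\<Sum>i\<in>I. weight d v N (W i))" by (rule weight_UN[OF v0 I(1)])
    also have "\<dots> \<le> (\<Sum>i\<in>I. c * max (diameter (W i)) (\<epsilon> * (1 / \<kappa>) ^ N) powr d)"
      unfolding c_def using I(2)
      by (intro sum_mono weight_le[OF \<open>0 < d\<close> v0 inv \<epsilon> \<kappa>]) auto
    also have "\<dots> \<le> (\<Sum>i\<in>I. c * (diameter (W i) powr d + (\<epsilon> * (1 / \<kappa>) ^ N) powr d))"
      using c by (intro sum_mono mult_left_mono) (auto simp: max_def)
    finally show ?thesis .
  qed
  have "(\<lambda>N. \<epsilon> * (1 / \<kappa>) ^ N) \<longlonglongrightarrow> \<epsilon> * 0"
    using \<kappa>(1) by (intro tendsto_intros LIMSEQ_power_zero) auto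
  then have lim: "(\<lambda>N. (\<epsilon> * (1 / \<kappa>) ^ N) powr d) \<longlonglongrightarrow> 0 powr d"
    using \<open>0 < d\<close> \<epsilon>(1) \<kappa>(1) by (intro tendsto_powr') auto
  have "(\<lambda>N. \<Sum>i\<in>I. c * (diameter (W i) powr d + (\<epsilon> * (1 / \<kappa>) ^ N) powr d))
      \<longlonglongrightarrow> (\<Sum>i\<in>I. c * (diameter (W i) powr d + 0 powr d))"
    by (intro tendsto_sum tendsto_mult tendsto_add tendsto_const lim)
  then have "v 0 \<le> (\<Sum>i\<in>I. c * (diameter (W i) powr d + 0 powr d))"
    by (rule LIMSEQ_le_const) (use bound in auto)
  then have "v 0 / c \<le> (\<Sum>i\<in>I. diameter (W i) powr d)"
    using c by (simp add: sum_distrib_left[symmetric] pos_divide_le_eq mult.commute)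
  then show ?thesis by (simp add: c_def)
qed

text \<open>A countable cover is thickened to an open one at small cost, and compactness then leaves
  a finite cover, for which the bound \<open>b\<close> is known. Half of \<open>b\<close> pays for
  the thickening.\<close>

lemma hausdorff_measure_C_pos:
  assumes "0 < d" and v: "\<And>j. j < n \<Longrightarrow> 0 < v j"
    and inv: "\<And>j. j < n \<Longrightarrow> (\<Sum>k\<in>clones_in j. (1 / K k) powr d * v (clone_type k)) = v j"
  shows "0 < hausdorff_measure d C"
proof -
  obtain \<epsilon> where \<epsilon>: "0 < \<epsilon>" "\<And>x. x \<in> C \<Longrightarrow> \<exists>k<m. C \<inter> ball x \<epsilon> \<subseteq> E k"
    using clone_separation by blast
  define b where "b = v 0 * \<epsilon> powr d / (\<Sum>j<n. v j)"
  have "0 < (\<Sum>j<n. v j)" using v n_pos by (intro sum_pos) auto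
  then have b: "0 < b" using v[OF n_pos] \<epsilon>(1) by (simp add: b_def)
  \<comment> \<open>Any positive scale would do, since the measure is the supremum over all
    scales.\<close>
  have "ennreal (b / 2) \<le> hausdorff_premeasure 1 d C"
  proof (rule hausdorff_premeasure_greatest)
    fix U :: "nat \<Rightarrow> 'a set"
    assume U: "C \<subseteq> \<Union> (range U)" "\<And>k. bounded (U k)"
    have diam0: "0 \<le> diameter (U k)" for k by (rule diameter_ge_0[OF U(2)])
    \<comment> \<open>Enlarging by radius \<open>\<eta>\<close> adds at most
      \<open>2 * \<eta>\<close> to the diameter. The allowances
      \<open>b / 2 * (1 / 2) ^ Suc k\<close> add up to \<open>b / 2\<close> over all
      \<open>k\<close>.\<close>
    have "\<exists>\<eta>>0. (diameter (U k) + 2 * \<eta>) powr d < diameter (U k) powr d + b / 2 * (1 / 2) ^ Suc k" for k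
    proof -
      have "((\<lambda>\<eta>. (diameter (U k) + 2 * \<eta>) powr d) \<longlongrightarrow> (diameter (U k) + 2 * 0) powr d) (at_right 0)"
        using \<open>0 < d\<close> diam0[of k]
        by (intro tendsto_powr' tendsto_intros) (auto simp: eventually_at_filter)
      then have "\<forall>\<^sub>F \<eta> in at_right 0. (diameter (U k) + 2 * \<eta>) powr d
          < diameter (U k) powr d + b / 2 * (1 / 2) ^ Suc k"
        using b by (intro order_tendstoD) auto
      from eventually_happens'[OF _ eventually_conj[OF this eventually_at_right_less[of 0]]]
      show ?thesis by auto
    qed
    then obtain \<eta> where \<eta>: "\<And>k. 0 < \<eta> k"
      "\<And>k. (diameter (U k) + 2 * \<eta> k) powr d < diameter (U k) powr d + b / 2 * (1 / 2) ^ Suc k"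
      by metis
    define V where "V k = (\<Union>y\<in>U k. ball y (\<eta> k))" for k
    have "C \<subseteq> (\<Union>k. V k)" using U(1) \<eta>(1) by (force simp: V_def)
    moreover have "open (V k)" for k by (auto simp: V_def)
    ultimately obtain I where I: "finite I" "C \<subseteq> (\<Union>k\<in>I. V k)"
      using compactE_image[OF compact_C, of UNIV V] by auto
    have diam: "diameter (C \<inter> V k) \<le> diameter (U k) + 2 * \<eta> k" for k
    proof -
      have "dist x y \<le> diameter (U k) + 2 * \<eta> k" if xy: "x \<in> V k" "y \<in> V k" for x y
      proof -
        from xy obtain p q where "p \<in> U k" "q \<in> U k" "dist p x < \<eta> k" "dist q y < \<eta> k"
          by (auto simp: V_def)
        moreover have "dist x y \<le> dist p x + dist p q + dist q y"
          using dist_triangle[of x y p] dist_triangle[of p y q] by (simp add: dist_commute)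
        moreover have "dist p q \<le> diameter (U k)"
          using calculation(1,2) by (rule diameter_bounded_bound[OF U(2)])
        ultimately show ?thesis by linarith
      qed
      moreover have "0 \<le> diameter (U k) + 2 * \<eta> k" using diam0[of k] \<eta>(1)[of k] by simp
      ultimately show ?thesis
        by (intro diameter_le_dist) auto
    qed
    have bdC: "bounded (C \<inter> V k)" for k
      using compact_imp_bounded[OF compact_C] by (rule bounded_subset) auto
    \<comment> \<open>The thickened sets may leave \<open>C\<close>, while the bound concerns
      subsets with union exactly \<open>C\<close>; hence the intersections.\<close>
    have "b \<le> (\<Sum>k\<in>I. diameter (C \<inter> V k) powr d)"
      unfolding b_def using I by (intro finite_cover_lower_bound[OF \<open>0 < d\<close> v inv \<epsilon>]) auto
    also have "\<dots> \<le> (\<Sum>k\<in>I. diameter (U k) powr d + b / 2 * (1 / 2) ^ Suc k)"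
    proof (rule sum_mono)
      fix k
      have "diameter (C \<inter> V k) powr d \<le> (diameter (U k) + 2 * \<eta> k) powr d"
        using diam[of k] \<open>0 < d\<close> diameter_ge_0[OF bdC[of k]] by (intro powr_mono2) auto
      with \<eta>(2)[of k] show "diameter (C \<inter> V k) powr d \<le> diameter (U k) powr d + b / 2 * (1 / 2) ^ Suc k"
        by simp
    qed
    also have "\<dots> = (\<Sum>k\<in>I. diameter (U k) powr d) + b / 2 * (\<Sum>k\<in>I. (1 / 2) ^ Suc k)"
      by (simp only: sum.distrib sum_distrib_left)
    also have "(\<Sum>k\<in>I. (1 / 2) ^ Suc k) \<le> (1 :: real)"
      using sum_le_suminf[OF sums_summable[OF power_half_series] I(1)] sums_unique[OF power_half_series]
      by simp
    finally have "b / 2 \<le> (\<Sum>k\<in>I. diameter (U k) powr d)"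
      using b by (simp add: mult_left_le)
    then have "ennreal (b / 2) \<le> ennreal (\<Sum>k\<in>I. diameter (U k) powr d)" by (rule ennreal_leI)
    also have "\<dots> = (\<Sum>k\<in>I. diam_pow d (U k))"
    proof -
      have "diam_pow d (U k) = ennreal (diameter (U k) powr d)" for k
        using \<open>0 < d\<close> by (simp add: diam_pow_def)
      then show ?thesis by (simp add: sum_ennreal)
    qed
    also have "\<dots> \<le> (\<Sum>k. diam_pow d (U k))" by (rule sum_le_suminf) (use I in auto)
    finally show "ennreal (b / 2) \<le> (\<Sum>k. diam_pow d (U k))" .
  qed
  also have "\<dots> \<le> hausdorff_measure d C" by (rule hausdorff_premeasure_le_measure) simp
  finally have "ennreal (b / 2) \<le> hausdorff_measure d C" .
  moreover have "0 < ennreal (b / 2)" using b by simp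
  ultimately show ?thesis by (rule less_le_trans[rotated])
qed

end

section \<open>The measures of the models as the normalized Frobenius eigenvector\<close>

theorem theorem1:
  fixes C :: "'a::metric_space set"
    and n :: nat and A :: "nat \<Rightarrow> 'a set"
    and m :: nat and E :: "nat \<Rightarrow> 'a set"
    and \<tau> :: "nat \<Rightarrow> 'a \<Rightarrow> 'a" and K :: "nat \<Rightarrow> real"
    and d :: real
  assumes "multi_model_cantor_set C n A m E \<tau> K"
    and "0 < d"
    and "irreducible_mat (mmcs_matrix n A m E \<tau> K d)"
    and "frobenius_eigenvalue (mmcs_matrix n A m E \<tau> K d) 1"
  shows "0 < hausdorff_measure d C \<and> hausdorff_measure d C < \<infinity> \<and>
    hausdorff_dimension C = ennreal d \<and>
    (\<exists>!v. frobenius_left_eigenvector (mmcs_matrix n A m E \<tau> K d) v \<and>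
          ennreal (\<Sum>i<n. v $ i) = hausdorff_measure d C) \<and>
    (\<forall>v. frobenius_left_eigenvector (mmcs_matrix n A m E \<tau> K d) v \<and>
          ennreal (\<Sum>i<n. v $ i) = hausdorff_measure d C \<longrightarrow>
          (\<forall>i<n. ennreal (v $ i) = hausdorff_measure d (A i)))"
proof -
  interpret multi_model_cantor_set C n A m E \<tau> K by fact
  define M where "M = mmcs_matrix n A m E \<tau> K d"
  have M: "M \<in> carrier_mat n n" by (simp add: M_def mmcs_matrix_carrier)
  have irr: "irreducible_mat M" and frob: "frobenius_eigenvalue M 1"
    using assms by (simp_all add: M_def)
  have act: "row_act M x j = (\<Sum>k\<in>clones_in j. (1 / K k) powr d * x (clone_type k))" if "j < n" for x j
    unfolding M_def by (rule row_act_mmcs_matrix[OF that])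
  \<comment> \<open>This auxiliary fixed vector drives the finiteness and positivity estimates. Its
    normalization is arbitrary, and the vector \<open>u\<close> of actual measures takes over
    afterwards.\<close>
  obtain w where w: "\<And>i. i < n \<Longrightarrow> 0 < w i" "\<And>j. j < n \<Longrightarrow> row_act M w j = w j"
    using positive_invariant_exists[OF M irr frob] by blast
  have winv: "(\<Sum>k\<in>clones_in j. (1 / K k) powr d * w (clone_type k)) = w j" if "j < n" for j
    using w(2)[OF that] act[OF that] by simp
  have pos: "0 < hausdorff_measure d C"
    by (rule hausdorff_measure_C_pos[OF \<open>0 < d\<close> w(1) winv])
  define u where "u j = enn2real (hausdorff_measure d (A j))" for j
  have u: "hausdorff_measure d (A j) = ennreal (u j)" if "j < n" for j
    using hausdorff_measure_model_finite[OF \<open>0 < d\<close> w(1) winv that] by (simp add: u_def)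
  have u0: "0 \<le> u j" for j by (simp add: u_def)
  have C: "hausdorff_measure d C = ennreal (\<Sum>j<n. u j)"
    unfolding hausdorff_measure_C using u u0 by (simp add: sum_ennreal)
  have inv: "row_act M u j = u j" if "j < n" for j
  proof -
    have "ennreal (u j) = (\<Sum>k\<in>clones_in j. ennreal ((1 / K k) powr d) * ennreal (u (clone_type k)))"
      using hausdorff_measure_model[OF that, of d] \<open>0 < d\<close> u[OF that] u clone_type(1) by simp
    also have "\<dots> = (\<Sum>k\<in>clones_in j. ennreal ((1 / K k) powr d * u (clone_type k)))"
      by (intro sum.cong refl ennreal_mult[symmetric] u0) simp
    also have "\<dots> = ennreal (row_act M u j)"
      unfolding act[OF that] by (rule sum_ennreal) (simp add: u0)
    finally show ?thesis
      using u0 act[OF that, of u] by (simp add: sum_nonneg)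
  qed
  \<comment> \<open>Positivity of the total measure makes some model measure nonzero, and
    primitivity then makes all of them positive.\<close>
  have "\<exists>i<n. u i \<noteq> 0"
  proof (rule ccontr)
    assume "\<not> (\<exists>i<n. u i \<noteq> 0)"
    with pos C show False by simp
  qed
  then obtain h where "h < n" "u h \<noteq> 0" by blast
  then have upos: "0 < u j" if "j < n" for j
    using invariant_pos[OF M irr u0 _ _ inv that] by blast
  have usum: "0 \<le> (\<Sum>j<n. u j)" using u0 by (intro sum_nonneg) auto
  have eig: "frobenius_left_eigenvector M (Matrix.vec n u)"
  proof (rule frobenius_left_eigenvectorI[OF M n_pos frob])
    fix j assume "j < n"
    have "row_act M (vec_index (Matrix.vec n u)) j = row_act M u j"
      using M by (intro fun_cong[OF row_act_cong]) simp
    with inv[OF \<open>j < n\<close>] \<open>j < n\<close> show "row_act M (vec_index (Matrix.vec n u)) j = Matrix.vec n u $ j" by simp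
  qed (use upos in auto)
  \<comment> \<open>Equal sums identify every normalized eigenvector with \<open>u\<close>. This
    gives both the uniqueness and the formula for its entries.\<close>
  have uniq: "v \<in> carrier_vec n \<and> (\<forall>i<n. v $ i = u i)"
    if "frobenius_left_eigenvector M v" "ennreal (\<Sum>i<n. v $ i) = hausdorff_measure d C" for v
  proof -
    note v = frobenius_left_eigenvectorD[OF M irr n_pos frob that(1)]
    have "0 \<le> (\<Sum>i<n. v $ i)" using v(2) by (intro sum_nonneg) (auto simp: less_imp_le)
    then have "(\<Sum>i<n. v $ i) = (\<Sum>j<n. u j)" using that(2) C usum by simp
    then show ?thesis
      using positive_invariant_unique[OF M irr v(2,3) upos inv] v(1) by blast
  qed
  have "\<exists>!v. frobenius_left_eigenvector M v \<and> ennreal (\<Sum>i<n. v $ i) = hausdorff_measure d C"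
  proof (rule ex1I)
    show "frobenius_left_eigenvector M (Matrix.vec n u) \<and>
        ennreal (\<Sum>i<n. Matrix.vec n u $ i) = hausdorff_measure d C"
      using eig C by simp
    show "v = Matrix.vec n u"
      if "frobenius_left_eigenvector M v \<and> ennreal (\<Sum>i<n. v $ i) = hausdorff_measure d C" for v
      using uniq[of v] that by (intro eq_vecI) auto
  qed
  moreover have "hausdorff_measure d C < \<infinity>" using C by simp
  moreover have "hausdorff_dimension C = ennreal d"
    using hausdorff_dimension_eq[OF \<open>0 < d\<close> pos] calculation(2) by blast
  ultimately show ?thesis
    using pos uniq u unfolding M_def by auto
qed

end
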